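(* Let $k\ge1$, $\theta_L\ge 2k+1$, $\theta_R\ge 2k+1$ be integers and let $G=(L\cup R,E)$ be a bipartite graph with maximum degree $d$. The worst-case time complexity of the algorithm PBIE used with the branch-and-bound algorithm FastBB (both specified in the context), run on $G,k,\theta_L,\theta_R$ for finding a MaxBP of $G$, is $$O\left(\log(\delta_{max}^R+k)\cdot|L|\cdot d^4\cdot\gamma_k^{d^3}\right),$$ where $\delta_{max}^R$ is the maximum degree of a vertex of $R$ and $\gamma_k$, a real number strictly smaller than $2$, is the largest positive real root of $x^{k+4}-2x^{k+3}+x^2-x+1=0$.
   Context: Graphs are finite, undirected bipartite graphs $G=(L\cup R,E)$. All subgraphs are induced: for $X\subseteq L$, $Y\subseteq R$, $G[X\cup Y]$ has vertex set $X\cup Y$ and all edges of $G$ between $X$ and $Y$. For a subgraph $H$, $V(H),L(H),R(H),E(H)$ are its vertex set, left side, right side and edge set. For a vertex $v$ and a set $A$ of vertices on the opposite side, $\Gamma(v,A)$ and $\overline\Gamma(v,A)$ are the sets of neighbours and non-neighbours of $v$ in $A$, with sizes $\delta(v,A)$ and $\overline\delta(v,A)$. $G[X\cup Y]$ is a $k$-biplex if $\overline\delta(v,Y)\le k$ for all $v\in X$ and $\overline\delta(u,X)\le k$ for all $u\in Y$. A $k$-biplex is maximal if no other $k$-biplex has a vertex set containing its vertex set. A MaxBP is a maximal $k$-biplex $H$ with $|L(H)|\ge\theta_L$, $|R(H)|\ge\theta_R$ and the most edges among all such maximal $k$-biplexes. **FastBB** is a recursive procedure on branches $(S,C,D)$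 of pairwise disjoint vertex sets ($S$: vertices that must be included; $C$: candidates; $D$: excluded vertices). Subscripts $L,R$ denote left and right parts. It maintains a best solution $H^*$. At a branch $(S,C,D)$ it does the following. (i) Termination: if $G[S\cup C]$ is a $k$-biplex, set $H^*\leftarrow G[S\cup C]$ if $|E(G[S\cup C])|>|E(H^* )|$, and return. (ii) Pruning: with $\tau_L=\min_{u\in S_R}\delta(u,S_L\cup C_L)+k$ and $\tau_R=\min_{v\in S_L}\delta(v,S_R\cup C_R)+k$, return if any of the following holds: (1) $G[S]$ is not a $k$-biplex; (2) $\tau_L$ (resp. $\tau_R$) is smaller than the given lower bound on the size of the left (resp. right) side; (3) $|E(G[S\cup C])|\le|E(H^* )|$ or $\tau_L\tau_R\le|E(H^* )|$; (4) there is $v\in D_L$ with $\overline\delta(v,S_R\cup C_R)\le k$ and $\{w\in S_R\cup C_R:\overline\delta(w,S_L\cup C_L)\ge k\}\subseteq\Gamma(v,R)$, or symmetrically such a vertex in $D_R$. (iii) Sym-BK branching: candidate pivots are the vertices of $S\cup C$ having more than $k$ non-neighbours on the opposite side within $S\cup C$. The pivot $\hat v$ is a candidate pivot in $S$ with the most such non-neighbours if there is a candidate pivot in $S$, and otherwise one in $C$ with the most such non-neighbours. Say $\hat v$ is on the left side (the other case is symmetric), and put $a=k-\overline\delta(\hat v,S_R)$. If $\hat v\in S$, order $C$ as $w_1,\dots,w_{|C|}$ with the vertices of $\overline\Gamma(\hat v,C_R)$ first and then the others (in any order within each group), and let $m=a+1$. If $\hat v\in C$, order $C$ with $\hat v$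 first, then $\overline\Gamma(\hat v,C_R)$, then the others, and let $m=a+2$. For $i=1,\dots,m$ recurse on the branch $S_i=S\cup\{w_1,\dots,w_{i-1}\}$, $D_i=D\cup\{w_i\}$, $C_i=C\setminus\{w_1,\dots,w_i\}$, where vertices that cannot be added to $G[S_i]$ to form a $k$-biplex are removed from $C_i$ and $D_i$. **PBIE with FastBB.** Let $\delta_{max}^R=\max_{u\in R}\delta(u,L)$, $\delta_{max}^L=\max_{v\in L}\delta(v,R)$, $LB_L^0=\delta_{max}^R+k$, and $H_0^*$ the empty graph. For $i=1,2,\dots$: set $UB_L^i=LB_L^{i-1}$, $LB_L^i=\max\{LB_L^{i-1}/2,\theta_L\}$, $LB_R^i=\max\{|E(H_{i-1}^* )|/UB_L^i,\theta_R\}$, $UB_R^i=\delta_{max}^L+k$. If $UB_L^i\le\theta_L$, return $H_{i-1}^*$. Otherwise let $G_i$ be the $(LB_R^i-k,LB_L^i-k)$-core of $G$ (the maximal subgraph whose left vertices have degree at least $LB_R^i-k$ and whose right vertices have degree at least $LB_L^i-k$), and put $H_i^*\leftarrow H_{i-1}^*$. Writing $L(G_i)=\{v_1,v_2,\dots\}$, for each $v_j$ let $G_i^{v_j}$ be the subgraph of $G_i$ induced by $L_j\cup R_j$, where $L_j$ is the set of 2-hop neighbours of $v_j$ in $L(G_i)$ (with $v_j$ itself included) minus $\{v_1,\dots,v_{j-1}\}$, and $R_j=\bigcup_{v\in L_j}\Gamma(v,R(G_i))$. From it are pruned the vertices $v\in L_j$ with $\delta(v,R_j)<\theta_R-k$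 or $|\Gamma(v,R_j)\cap\Gamma(v_j,R)|<\theta_R-2k$, and the vertices $u\in R_j$ with $\delta(u,L_j)<\theta_L-k$. Then FastBB is run on $G_i^{v_j}$ from the branch $S=\{v_j\}$, $D=\{v_1,\dots,v_{j-1}\}$, $C=V(G_i^{v_j})\setminus\{v_1,\dots,v_j\}$, with current best solution $H^*=H_i^*$, lower bounds $LB_L^i,LB_R^i$ on the side sizes, and the extra pruning rule that a branch is discarded if $|S_L|>UB_L^i$ or $|S_R|>UB_R^i$. $H_i^*$ is set to the resulting $H^*$. *)

theory Defs
  imports Complex_Main "HOL-Library.Extended_Real"
begin

section \<open>Bipartite graphs and biplexes\<close>

record 'v bigraph =
  lefts :: "'v set"
  rights :: "'v set"
  edges :: "('v \<times> 'v) set"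

definition wf_bigraph :: "'v bigraph \<Rightarrow> bool" where
  "wf_bigraph G \<longleftrightarrow> finite (lefts G) \<and> finite (rights G) \<and> lefts G \<inter> rights G = {} \<and>
     edges G \<subseteq> lefts G \<times> rights G"

definition verts :: "'v bigraph \<Rightarrow> 'v set" where
  "verts G = lefts G \<union> rights G"

definition adj :: "'v bigraph \<Rightarrow> 'v \<Rightarrow> 'v \<Rightarrow> bool" where
  "adj G v w \<longleftrightarrow> (v, w) \<in> edges G \<or> (w, v) \<in> edges G"

definition opp :: "'v bigraph \<Rightarrow> 'v \<Rightarrow> 'v set" where
  "opp G v = (if v \<in> lefts G then rights G else lefts G)"

text \<open>The set \<open>A\<close> may contain vertices of both sides; only its vertices on the side opposite
  to \<open>v\<close> count, so that for a left vertex \<open>v\<close> the set \<open>nonnbrs G v A\<close> is the set of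
  non-neighbours of \<open>v\<close> in \<open>A \<inter> rights G\<close>.\<close>

definition nbrs :: "'v bigraph \<Rightarrow> 'v \<Rightarrow> 'v set \<Rightarrow> 'v set" where
  "nbrs G v A = {w \<in> A. adj G v w}"

definition nonnbrs :: "'v bigraph \<Rightarrow> 'v \<Rightarrow> 'v set \<Rightarrow> 'v set" where
  "nonnbrs G v A = {w \<in> A \<inter> opp G v. \<not> adj G v w}"

definition deg :: "'v bigraph \<Rightarrow> 'v \<Rightarrow> 'v set \<Rightarrow> nat" where
  "deg G v A = card (nbrs G v A)"

definition nondeg :: "'v bigraph \<Rightarrow> 'v \<Rightarrow> 'v set \<Rightarrow> nat" where
  "nondeg G v A = card (nonnbrs G v A)"

definition max_deg :: "'v bigraph \<Rightarrow> 'v set \<Rightarrow> nat" where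
  "max_deg G A = Max ((\<lambda>v. deg G v (verts G)) ` A)"

text \<open>Induced subgraphs are represented by their vertex sets.\<close>

definition num_edges :: "'v bigraph \<Rightarrow> 'v set \<Rightarrow> nat" where
  "num_edges G X = card (edges G \<inter> X \<times> X)"

definition biplex :: "'v bigraph \<Rightarrow> nat \<Rightarrow> 'v set \<Rightarrow> bool" where
  "biplex G k X \<longleftrightarrow> (\<forall>v \<in> X. nondeg G v X \<le> k)"

text \<open>The subgraphs satisfying the degree conditions are closed under union, so the union of all
  of them is the maximal one.\<close>

definition core :: "'v bigraph \<Rightarrow> real \<Rightarrow> real \<Rightarrow> 'v set" where
  "core G a b = \<Union>{X. X \<subseteq> verts G \<and> (\<forall>v \<in> X \<inter> lefts G. a \<le> real (deg G v X)) \<and>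
     (\<forall>u \<in> X \<inter> rights G. b \<le> real (deg G u X))}"

section \<open>Cost model\<close>

text \<open>Time is counted on a unit-cost random access machine: testing one pair of vertices for
  adjacency, testing membership of a vertex in a set, visiting one entry of an adjacency list and
  one arithmetic operation take constant time. A loop over a set performs its body once for every
  element; there is no early exit and nothing is remembered between two evaluations. The functions
  \<open>T_f\<close> give the time of the evaluation of the corresponding test or construction.

  The input consists of the list of left vertices with their adjacency lists. Isolated right
  vertices occur in none of these lists and are never visited.\<close>

definition loop_time :: "'a set \<Rightarrow> ('a \<Rightarrow> nat) \<Rightarrow> nat" where
  "loop_time A t = 1 + (\<Sum>x\<in>A. 1 + t x)"

text \<open>Counting or listing the neighbours or non-neighbours of a vertex in \<open>X\<close> by adjacency
  tests.\<close>

definition T_nbrs :: "'v set \<Rightarrow> nat" where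
  "T_nbrs X = loop_time X (\<lambda>_. 1)"

definition T_biplex :: "'v set \<Rightarrow> nat" where
  "T_biplex X = loop_time X (\<lambda>_. T_nbrs X)"

definition T_num_edges :: "'v set \<Rightarrow> nat" where
  "T_num_edges X = loop_time X (\<lambda>_. T_nbrs X)"

text \<open>Traversal of the whole adjacency list of a vertex, and of the lists of all vertices in
  \<open>X\<close>.\<close>

definition T_adj_list :: "'v bigraph \<Rightarrow> 'v \<Rightarrow> nat" where
  "T_adj_list G v = loop_time (nbrs G v (verts G)) (\<lambda>_. 1)"

definition T_adj_lists :: "'v bigraph \<Rightarrow> 'v set \<Rightarrow> nat" where
  "T_adj_lists G X = loop_time X (T_adj_list G)"

text \<open>A test on the excluded vertices \<open>D\<close> that only compares their adjacencies to \<open>X\<close>. The set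
  \<open>D\<close> may contain nearly all left vertices of the graph, hence it is not scanned: the members of
  \<open>D\<close> with a neighbour in \<open>X\<close> are found through the adjacency lists of \<open>X\<close> and tested one by one;
  all the other members of \<open>D\<close> on the same side agree on the test, which is decided for all of
  them by the numbers of non-neighbours within \<open>X\<close>.\<close>

definition T_excluded :: "'v bigraph \<Rightarrow> 'v set \<Rightarrow> 'v set \<Rightarrow> ('v \<Rightarrow> nat) \<Rightarrow> nat" where
  "T_excluded G X D t =
     T_adj_lists G X + loop_time {v \<in> D. nbrs G v X \<noteq> {}} t + T_biplex X"

section \<open>FastBB\<close>

text \<open>A branch is a triple \<open>(S, C, D)\<close>.\<close>

type_synonym 'v branch = "'v set \<times> 'v set \<times> 'v set"

record side_bounds =
  lb_left :: real
  lb_right :: real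
  ub_left :: real
  ub_right :: real

text \<open>The minimum over the empty set is \<open>\<infinity>\<close>.\<close>

definition tau_left :: "'v bigraph \<Rightarrow> nat \<Rightarrow> 'v set \<Rightarrow> 'v set \<Rightarrow> ereal" where
  "tau_left G k S C = (INF u \<in> S \<inter> rights G. ereal (real (deg G u (S \<union> C)))) + ereal (real k)"

definition tau_right :: "'v bigraph \<Rightarrow> nat \<Rightarrow> 'v set \<Rightarrow> 'v set \<Rightarrow> ereal" where
  "tau_right G k S C = (INF v \<in> S \<inter> lefts G. ereal (real (deg G v (S \<union> C)))) + ereal (real k)"

definition dominated :: "'v bigraph \<Rightarrow> nat \<Rightarrow> 'v branch \<Rightarrow> bool" where
  "dominated G k = (\<lambda>(S, C, D). \<exists>v \<in> D. nondeg G v (S \<union> C) \<le> k \<and>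
     {w \<in> (S \<union> C) \<inter> opp G v. k \<le> nondeg G w (S \<union> C)} \<subseteq> nbrs G v (verts G))"

definition pruned :: "'v bigraph \<Rightarrow> nat \<Rightarrow> side_bounds \<Rightarrow> 'v branch \<Rightarrow> 'v set \<Rightarrow> bool" where
  "pruned G k B = (\<lambda>(S, C, D) H.
     \<not> biplex G k S \<or>
     tau_left G k S C < ereal (lb_left B) \<or> tau_right G k S C < ereal (lb_right B) \<or>
     num_edges G (S \<union> C) \<le> num_edges G H \<or>
     tau_left G k S C * tau_right G k S C \<le> ereal (real (num_edges G H)) \<or>
     dominated G k (S, C, D) \<or>
     real (card (S \<inter> lefts G)) > ub_left B \<or> real (card (S \<inter> rights G)) > ub_right B)"

definition pivots :: "'v bigraph \<Rightarrow> nat \<Rightarrow> 'v set \<Rightarrow> 'v set \<Rightarrow> 'v set" where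
  "pivots G k S C = {v \<in> S \<union> C. k < nondeg G v (S \<union> C)}"

definition is_pivot :: "'v bigraph \<Rightarrow> nat \<Rightarrow> 'v set \<Rightarrow> 'v set \<Rightarrow> 'v \<Rightarrow> bool" where
  "is_pivot G k S C v \<longleftrightarrow>
     (let P = (if pivots G k S C \<inter> S \<noteq> {} then pivots G k S C \<inter> S else pivots G k S C)
      in v \<in> P \<and> (\<forall>u \<in> P. nondeg G u (S \<union> C) \<le> nondeg G v (S \<union> C)))"

definition branch_order :: "'v bigraph \<Rightarrow> 'v set \<Rightarrow> 'v set \<Rightarrow> 'v \<Rightarrow> 'v list \<Rightarrow> bool" where
  "branch_order G S C v ws \<longleftrightarrow> distinct ws \<and>
     (\<exists>us zs. set us = nonnbrs G v C \<and>
        (if v \<in> S then ws = us @ zs \<and> set zs = C - nonnbrs G v C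
         else ws = v # us @ zs \<and> set zs = C - nonnbrs G v C - {v}))"

text \<open>In every branch that is reached, \<open>v\<close> has at most \<open>k\<close> non-neighbours in \<open>S\<close>, so the
  subtraction is not truncated.\<close>

definition num_children :: "'v bigraph \<Rightarrow> nat \<Rightarrow> 'v set \<Rightarrow> 'v \<Rightarrow> nat" where
  "num_children G k S v =
     (let a = k - nondeg G v S in if v \<in> S then a + 1 else a + 2)"

text \<open>The index \<open>j\<close> starts from \<open>0\<close>: \<open>child G k b ws j\<close> is the branch in which
  \<open>ws ! j\<close> is excluded and its predecessors are included.\<close>

definition child :: "'v bigraph \<Rightarrow> nat \<Rightarrow> 'v branch \<Rightarrow> 'v list \<Rightarrow> nat \<Rightarrow> 'v branch" where
  "child G k = (\<lambda>(S, C, D) ws j.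
     let S' = S \<union> set (take j ws) in
       (S',
        {v \<in> C - set (take (Suc j) ws). biplex G k (insert v S')},
        {v \<in> insert (ws ! j) D. biplex G k (insert v S')}))"

definition T_leaf :: "'v branch \<Rightarrow> nat" where
  "T_leaf = (\<lambda>(S, C, D). T_biplex (S \<union> C) + T_num_edges (S \<union> C) + loop_time (S \<union> C) (\<lambda>_. 1))"

definition T_prune :: "'v bigraph \<Rightarrow> 'v branch \<Rightarrow> nat" where
  "T_prune G = (\<lambda>(S, C, D).
     T_biplex S + loop_time S (\<lambda>_. T_nbrs (S \<union> C)) + T_num_edges (S \<union> C) +
     T_excluded G (S \<union> C) D (\<lambda>_. T_nbrs (S \<union> C) + loop_time (S \<union> C) (\<lambda>_. T_nbrs (S \<union> C))))"

definition T_child :: "'v bigraph \<Rightarrow> 'v branch \<Rightarrow> 'v list \<Rightarrow> nat \<Rightarrow> nat" where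
  "T_child G = (\<lambda>(S, C, D) ws j.
     let S' = S \<union> set (take j ws) in
       loop_time (S \<union> C) (\<lambda>_. 1) +
       loop_time (C - set (take (Suc j) ws)) (\<lambda>v. T_biplex (insert v S')) +
       T_excluded G S' (insert (ws ! j) D) (\<lambda>v. T_biplex (insert v S')))"

text \<open>Selection of the pivot, ordering of the candidates, and construction of the first \<open>m\<close>
  children.\<close>

definition T_branch :: "'v bigraph \<Rightarrow> 'v branch \<Rightarrow> 'v list \<Rightarrow> nat \<Rightarrow> nat" where
  "T_branch G = (\<lambda>(S, C, D) ws m.
     loop_time (S \<union> C) (\<lambda>_. T_nbrs (S \<union> C)) + (T_nbrs S + T_nbrs C + loop_time C (\<lambda>_. 1)) +
     loop_time {..<m} (T_child G (S, C, D) ws))"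

text \<open>\<open>fastbb G k B b H H' t\<close>: on the branch \<open>b\<close> with the current best solution \<open>H\<close>, some
  execution of the recursive procedure ends with the best solution \<open>H'\<close> after time \<open>t\<close>.
  Executions differ in the choice among equally good pivots and in the order of the candidates.\<close>

inductive fastbb :: "'v bigraph \<Rightarrow> nat \<Rightarrow> side_bounds \<Rightarrow> 'v branch \<Rightarrow> 'v set \<Rightarrow> 'v set \<Rightarrow> nat \<Rightarrow> bool"
  and fastbb_list :: "'v bigraph \<Rightarrow> nat \<Rightarrow> side_bounds \<Rightarrow> 'v branch list \<Rightarrow> 'v set \<Rightarrow> 'v set \<Rightarrow> nat \<Rightarrow> bool"
  for G :: "'v bigraph" and k :: nat and B :: side_bounds
where
  terminate:
    "biplex G k (S \<union> C) \<Longrightarrow>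
     H' = (if num_edges G (S \<union> C) > num_edges G H then S \<union> C else H) \<Longrightarrow>
     fastbb G k B (S, C, D) H H' (T_leaf (S, C, D))"
| prune:
    "\<not> biplex G k (S \<union> C) \<Longrightarrow> pruned G k B (S, C, D) H \<Longrightarrow>
     fastbb G k B (S, C, D) H H (T_leaf (S, C, D) + T_prune G (S, C, D))"
| branch:
    "\<not> biplex G k (S \<union> C) \<Longrightarrow> \<not> pruned G k B (S, C, D) H \<Longrightarrow>
     is_pivot G k S C v \<Longrightarrow> branch_order G S C v ws \<Longrightarrow> m = num_children G k S v \<Longrightarrow>
     fastbb_list G k B (map (child G k (S, C, D) ws) [0..<m]) H H' t \<Longrightarrow>
     fastbb G k B (S, C, D) H H'
       (T_leaf (S, C, D) + T_prune G (S, C, D) + T_branch G (S, C, D) ws m + t)"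
| empty:
    "fastbb_list G k B [] H H 1"
| step:
    "fastbb G k B b H H1 t1 \<Longrightarrow> fastbb_list G k B bs H1 H2 t2 \<Longrightarrow>
     fastbb_list G k B (b # bs) H H2 (1 + t1 + t2)"

section \<open>PBIE\<close>

text \<open>\<open>X\<close> is the vertex set of the core, and \<open>P\<close> is the set of the vertices preceding \<open>v\<close> in the
  enumeration of the left side of the core.\<close>

definition hop_left :: "'v bigraph \<Rightarrow> 'v set \<Rightarrow> 'v set \<Rightarrow> 'v \<Rightarrow> 'v set" where
  "hop_left G X P v =
     insert v {w \<in> X \<inter> lefts G. \<exists>u \<in> X \<inter> rights G. adj G v u \<and> adj G w u} - P"

definition hop_right :: "'v bigraph \<Rightarrow> 'v set \<Rightarrow> 'v set \<Rightarrow> 'v \<Rightarrow> 'v set" where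
  "hop_right G X P v = (\<Union>w \<in> hop_left G X P v. nbrs G w (X \<inter> rights G))"

text \<open>All degrees in the pruning conditions refer to the subgraph before pruning.\<close>

definition local_verts ::
  "'v bigraph \<Rightarrow> nat \<Rightarrow> nat \<Rightarrow> nat \<Rightarrow> 'v set \<Rightarrow> 'v set \<Rightarrow> 'v \<Rightarrow> 'v set" where
  "local_verts G k \<theta>\<^sub>L \<theta>\<^sub>R X P v =
     (let A = hop_left G X P v; Z = hop_right G X P v in
        {w \<in> A. int (deg G w Z) \<ge> int \<theta>\<^sub>R - int k \<and>
           int (card (nbrs G w Z \<inter> nbrs G v (rights G))) \<ge> int \<theta>\<^sub>R - 2 * int k} \<union>
        {u \<in> Z. int (deg G u A) \<ge> int \<theta>\<^sub>L - int k})"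

definition start_branch ::
  "'v bigraph \<Rightarrow> nat \<Rightarrow> nat \<Rightarrow> nat \<Rightarrow> 'v set \<Rightarrow> 'v set \<Rightarrow> 'v \<Rightarrow> 'v branch" where
  "start_branch G k \<theta>\<^sub>L \<theta>\<^sub>R X P v = ({v}, local_verts G k \<theta>\<^sub>L \<theta>\<^sub>R X P v - P - {v}, P)"

text \<open>Both sides are collected by traversing adjacency lists, then each vertex found is tested by
  adjacency tests. The set \<open>P\<close> of excluded vertices grows by one vertex from one start branch to
  the next and is not rebuilt.\<close>

definition T_start_branch :: "'v bigraph \<Rightarrow> 'v set \<Rightarrow> 'v set \<Rightarrow> 'v \<Rightarrow> nat" where
  "T_start_branch G X P v =
     (let A = hop_left G X P v; Z = hop_right G X P v in
        T_adj_list G v + T_adj_lists G (nbrs G v (verts G)) + T_adj_lists G A +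
        loop_time A (\<lambda>_. T_nbrs Z + T_nbrs Z) + loop_time Z (\<lambda>_. T_nbrs A) +
        loop_time (A \<union> Z) (\<lambda>_. 1))"

text \<open>\<open>pbie_scan G k \<theta>\<^sub>L \<theta>\<^sub>R B X vs ws H H' t\<close>: the vertices of the list \<open>ws\<close> are processed
  one after the other; those of \<open>vs\<close> have been processed before.\<close>

inductive pbie_scan ::
  "'v bigraph \<Rightarrow> nat \<Rightarrow> nat \<Rightarrow> nat \<Rightarrow> side_bounds \<Rightarrow> 'v set \<Rightarrow> 'v list \<Rightarrow> 'v list \<Rightarrow>
   'v set \<Rightarrow> 'v set \<Rightarrow> nat \<Rightarrow> bool"
  for G :: "'v bigraph" and k \<theta>\<^sub>L \<theta>\<^sub>R :: nat and B :: side_bounds and X :: "'v set"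
where
  scan_end:
    "pbie_scan G k \<theta>\<^sub>L \<theta>\<^sub>R B X vs [] H H 1"
| scan_step:
    "fastbb G k B (start_branch G k \<theta>\<^sub>L \<theta>\<^sub>R X (set vs) v) H H1 t1 \<Longrightarrow>
     pbie_scan G k \<theta>\<^sub>L \<theta>\<^sub>R B X (vs @ [v]) ws H1 H2 t2 \<Longrightarrow>
     pbie_scan G k \<theta>\<^sub>L \<theta>\<^sub>R B X vs (v # ws) H H2
       (1 + T_start_branch G X (set vs) v + t1 + t2)"

text \<open>The core is computed by peeling: the adjacency list of each non-isolated vertex is traversed
  once to obtain its degree and at most once more when the vertex is deleted.\<close>

definition T_core :: "'v bigraph \<Rightarrow> nat" where
  "T_core G = 2 * T_adj_lists G (lefts G \<union> {u \<in> rights G. nbrs G u (lefts G) \<noteq> {}})"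

text \<open>Construction of the adjacency lists of the right vertices and computation of the two maximum
  degrees.\<close>

definition T_setup :: "'v bigraph \<Rightarrow> nat" where
  "T_setup G = 2 * T_adj_lists G (lefts G \<union> {u \<in> rights G. nbrs G u (lefts G) \<noteq> {}})"

text \<open>\<open>pbie_loop G k \<theta>\<^sub>L \<theta>\<^sub>R UBL H H' t\<close>: execution from the beginning of a round with left
  upper bound \<open>UBL\<close>, which is the left lower bound of the round before; the bounds are real numbers
  and are not rounded.\<close>

inductive pbie_loop ::
  "'v bigraph \<Rightarrow> nat \<Rightarrow> nat \<Rightarrow> nat \<Rightarrow> real \<Rightarrow> 'v set \<Rightarrow> 'v set \<Rightarrow> nat \<Rightarrow> bool"
  for G :: "'v bigraph" and k \<theta>\<^sub>L \<theta>\<^sub>R :: nat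
where
  loop_end:
    "UBL \<le> real \<theta>\<^sub>L \<Longrightarrow> pbie_loop G k \<theta>\<^sub>L \<theta>\<^sub>R UBL H H 1"
| loop_step:
    "UBL > real \<theta>\<^sub>L \<Longrightarrow>
     LBL = max (UBL / 2) (real \<theta>\<^sub>L) \<Longrightarrow>
     LBR = max (real (num_edges G H) / UBL) (real \<theta>\<^sub>R) \<Longrightarrow>
     UBR = real (max_deg G (lefts G) + k) \<Longrightarrow>
     X = core G (LBR - real k) (LBL - real k) \<Longrightarrow>
     distinct vs \<Longrightarrow> set vs = X \<inter> lefts G \<Longrightarrow>
     pbie_scan G k \<theta>\<^sub>L \<theta>\<^sub>R
       \<lparr>lb_left = LBL, lb_right = LBR, ub_left = UBL, ub_right = UBR\<rparr> X [] vs H H1 t1 \<Longrightarrow>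
     pbie_loop G k \<theta>\<^sub>L \<theta>\<^sub>R LBL H1 H2 t2 \<Longrightarrow>
     pbie_loop G k \<theta>\<^sub>L \<theta>\<^sub>R UBL H H2 (1 + T_core G + t1 + t2)"

text \<open>\<open>pbie G k \<theta>\<^sub>L \<theta>\<^sub>R H t\<close>: some execution of PBIE with FastBB returns \<open>H\<close> after time
  \<open>t\<close>.\<close>

definition pbie :: "'v bigraph \<Rightarrow> nat \<Rightarrow> nat \<Rightarrow> nat \<Rightarrow> 'v set \<Rightarrow> nat \<Rightarrow> bool" where
  "pbie G k \<theta>\<^sub>L \<theta>\<^sub>R H t \<longleftrightarrow>
     (\<exists>t'. pbie_loop G k \<theta>\<^sub>L \<theta>\<^sub>R (real (max_deg G (rights G) + k)) {} H t' \<and>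
           t = T_setup G + t')"

section \<open>The branching constant\<close>

definition largest_pos_root :: "nat \<Rightarrow> real \<Rightarrow> bool" where
  "largest_pos_root k \<gamma> \<longleftrightarrow>
     (let R = {x. 0 < x \<and> x ^ (k + 4) - 2 * x ^ (k + 3) + x ^ 2 - x + 1 = 0}
      in \<gamma> \<in> R \<and> (\<forall>x \<in> R. x \<le> \<gamma>))"

end

theory Submission
  imports Defs "HOL-Real_Asymp.Real_Asymp"
begin

text \<open>Every branch of FastBB on candidates \<open>C\<close> produces children in which at least \<open>1, 2, \<dots>\<close>
  candidates have been removed, hence there are at most \<open>2 ^ card C\<close> nodes, whatever the pruning.
  A right vertex of a local subgraph keeps at least \<open>\<theta>\<^sub>L - k \<ge> k + 1 \<ge> 2\<close> left neighbours among at
  most \<open>d\<^sup>2 + 1\<close> left vertices of degree at most \<open>d\<close>, so that \<open>card C\<close> is at most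
  \<open>d\<^sup>3 / 2 + O(d\<^sup>2)\<close>. Since \<open>\<gamma>\<^sub>k \<ge> 3 / 2 > \<surd>2\<close>, the number of nodes times any fixed power of \<open>d\<close> is
  \<open>O(\<gamma>\<^sub>k ^ d\<^sup>3)\<close>, uniformly in \<open>k\<close>.\<close>

section \<open>The branching constant\<close>

text \<open>In the form \<open>x ^ (k + 3) * (x - 2) + x * (x - 1) + 1\<close> the polynomial is
  visibly positive from 2 on. It is negative at 3/2, since \<open>k \<ge> 1\<close> and (3/2)^4 / 2
  > 7/4. The lower bound 3/2 is what the growth comparison uses: its square exceeds 2.\<close>

lemma largest_pos_root_exists:
  assumes "1 \<le> k"
  shows "\<exists>\<gamma>. largest_pos_root k \<gamma> \<and> 3 / 2 \<le> \<gamma> \<and> \<gamma> < 2"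
proof -
  define f :: "real \<Rightarrow> real" where "f x = x ^ (k + 4) - 2 * x ^ (k + 3) + x ^ 2 - x + 1" for x
  have f_eq: "f x = x ^ (k + 3) * (x - 2) + x * (x - 1) + 1" for x
    by (simp add: f_def algebra_simps power_add power2_eq_square eval_nat_numeral)
  have f_pos: "0 < f x" if "2 \<le> x" for x
  proof -
    have "0 \<le> x ^ (k + 3) * (x - 2)" "0 \<le> x * (x - 1)"
      using that by auto
    then show ?thesis by (simp add: f_eq)
  qed
  have "(3 / 2 :: real) ^ 4 \<le> (3 / 2) ^ (k + 3)"
    using assms by (intro power_increasing) auto
  then have neg: "f (3 / 2) \<le> 0"
    by (simp add: f_eq eval_nat_numeral)
  have cont: "continuous_on A f" for A
    unfolding f_def by (intro continuous_intros)
  obtain r where r: "3 / 2 \<le> r" "r \<le> 2" "f r = 0"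
    using IVT'[of f "3 / 2" 0 2] neg f_pos[of 2] cont by auto
  \<comment> \<open>Roots below 3/2 lie below the root \<open>r\<close>, so the largest root can be
    sought in this compact set.\<close>
  define Z where "Z = {3 / 2..2} \<inter> {x. f x = 0}"
  have "compact Z"
    unfolding Z_def by (intro compact_Int_closed compact_Icc closed_Collect_eq cont continuous_on_const)
  moreover have "Z \<noteq> {}"
    using r by (auto simp: Z_def)
  ultimately obtain \<gamma> where \<gamma>: "\<gamma> \<in> Z" "\<forall>x\<in>Z. x \<le> \<gamma>"
    using compact_attains_sup by blast
  have "x \<le> \<gamma>" if "f x = 0" for x
    using that \<gamma> f_pos[of x] by (cases "3 / 2 \<le> x"; cases "2 \<le> x") (auto simp: Z_def)
  moreover have "\<gamma> < 2"
    using \<gamma> f_pos[of \<gamma>] by (force simp: Z_def)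
  moreover have "3 / 2 \<le> \<gamma>" "f \<gamma> = 0"
    using \<gamma> by (auto simp: Z_def)
  ultimately show ?thesis
    unfolding largest_pos_root_def Let_def f_def[symmetric] by (intro exI[of _ \<gamma>]) auto
qed

text \<open>Both sides are compared after squaring, which removes the halved exponent. As (3/2)^2 =
  2 * 9/8, the square of the right side has a factor (9/8)^(d^3) to spare over 2^(d^3), and this
  outgrows d^18 * 8^(d^2). The constant is independent of \<gamma>, hence of the parameter
  \<open>k\<close> of the biplexes.\<close>

lemma poly_times_two_power_bounded:
  "\<exists>c::real. 1 \<le> c \<and>
     (\<forall>(d::nat) e \<gamma>. 2 * e \<le> d ^ 3 + 3 * d ^ 2 \<longrightarrow> 3 / 2 \<le> \<gamma> \<longrightarrow>
        real d ^ 9 * 2 ^ e \<le> c * \<gamma> ^ (d ^ 3))"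
proof -
  define g :: "nat \<Rightarrow> real" where "g d = real d ^ 18 * 8 ^ (d ^ 2) / (9 / 8) ^ (d ^ 3)" for d
  have "g \<longlonglongrightarrow> 0"
    unfolding g_def by real_asymp
  then have "Bseq g"
    by (intro convergent_imp_Bseq convergentI)
  then obtain b where b: "\<And>d. \<bar>g d\<bar> \<le> b"
    by (auto simp: Bseq_def)
  \<comment> \<open>\<open>c \<ge> 1\<close> gives \<open>c \<le> c\<^sup>2\<close>, so that the
    right side can be completed to a square.\<close>
  define c where "c = max 1 b"
  have "real d ^ 9 * 2 ^ e \<le> c * \<gamma> ^ (d ^ 3)"
    if e: "2 * e \<le> d ^ 3 + 3 * d ^ 2" and \<gamma>: "3 / 2 \<le> \<gamma>" for d e :: nat and \<gamma> :: real
  proof -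
    have "g d \<le> c"
      using b[of d] by (auto simp: c_def)
    then have "real d ^ 18 * 8 ^ (d ^ 2) \<le> c * (9 / 8) ^ (d ^ 3)"
      by (simp add: g_def pos_divide_le_eq)
    also have "\<dots> \<le> c\<^sup>2 * (9 / 8) ^ (d ^ 3)"
      by (intro mult_right_mono self_le_power) (auto simp: c_def)
    finally have *: "real d ^ 18 * 8 ^ (d ^ 2) \<le> c\<^sup>2 * (9 / 8) ^ (d ^ 3)" .
    have "(real d ^ 9 * 2 ^ e)\<^sup>2 = real d ^ 18 * 2 ^ (2 * e)"
      by (simp add: power_mult_distrib power_even_eq flip: power_mult)
    also have "\<dots> \<le> real d ^ 18 * 2 ^ (d ^ 3 + 3 * d ^ 2)"
      using e by (intro mult_left_mono power_increasing) auto
    also have "\<dots> = (real d ^ 18 * 8 ^ (d ^ 2)) * 2 ^ (d ^ 3)"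
      by (simp add: power_add power_mult)
    also have "\<dots> \<le> (c\<^sup>2 * (9 / 8) ^ (d ^ 3)) * 2 ^ (d ^ 3)"
      using * by (intro mult_right_mono) auto
    also have "\<dots> = (c * (3 / 2) ^ (d ^ 3))\<^sup>2"
    proof -
      have "((3 / 2 :: real) ^ (d ^ 3))\<^sup>2 = (9 / 8 * 2) ^ (d ^ 3)"
        by (subst power_mult[symmetric], subst mult.commute, subst power_mult)
           (simp add: power2_eq_square)
      then show ?thesis
        by (simp only: power_mult_distrib mult.assoc)
    qed
    finally have "real d ^ 9 * 2 ^ e \<le> c * (3 / 2) ^ (d ^ 3)"
      by (rule power2_le_imp_le) (simp add: c_def)
    also have "\<dots> \<le> c * \<gamma> ^ (d ^ 3)"
      using \<gamma> by (intro mult_left_mono power_mono) (auto simp: c_def)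
    finally show ?thesis .
  qed
  then show ?thesis
    by (intro exI[of _ c]) (auto simp: c_def)
qed

section \<open>Running time of a node\<close>

lemma nonnbrs_mono: "A \<subseteq> A' \<Longrightarrow> nonnbrs G v A \<subseteq> nonnbrs G v A'"
  by (auto simp: nonnbrs_def)

lemma nondeg_mono: "finite A' \<Longrightarrow> A \<subseteq> A' \<Longrightarrow> nondeg G v A \<le> nondeg G v A'"
  unfolding nondeg_def by (intro card_mono nonnbrs_mono) (auto simp: nonnbrs_def)

lemma nondeg_Un_le: "nondeg G v (A \<union> A') \<le> nondeg G v A + nondeg G v A'"
proof -
  have "nonnbrs G v (A \<union> A') = nonnbrs G v A \<union> nonnbrs G v A'"
    by (auto simp: nonnbrs_def)
  then show ?thesis
    by (simp add: nondeg_def card_Un_le)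
qed

lemma nondeg_le_card: "finite A \<Longrightarrow> nondeg G v A \<le> card A"
  unfolding nondeg_def by (intro card_mono) (auto simp: nonnbrs_def)

lemma loop_time_le:
  assumes "finite A" "\<And>x. x \<in> A \<Longrightarrow> t x \<le> c" "card A \<le> n"
  shows "loop_time A t \<le> 1 + n * (1 + c)"
proof -
  have "(\<Sum>x\<in>A. 1 + t x) \<le> card A * (1 + c)"
    using sum_bounded_above[of A "\<lambda>x. 1 + t x" "1 + c"] assms(2) by auto
  also have "\<dots> \<le> n * (1 + c)"
    using assms(3) by (rule mult_le_mono1)
  finally show ?thesis
    by (simp add: loop_time_def)
qed

lemma T_nbrs_le: "finite X \<Longrightarrow> card X \<le> n \<Longrightarrow> T_nbrs X \<le> 1 + 2 * n"
  unfolding T_nbrs_def using loop_time_le[of X "\<lambda>_. 1" 1 n] by simp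

lemma T_biplex_le: "finite X \<Longrightarrow> card X \<le> n \<Longrightarrow> T_biplex X \<le> 1 + n * (2 + 2 * n)"
  unfolding T_biplex_def using loop_time_le[of X "\<lambda>_. T_nbrs X" "1 + 2 * n" n] T_nbrs_le[of X n]
  by simp

lemma T_num_edges_le: "finite X \<Longrightarrow> card X \<le> n \<Longrightarrow> T_num_edges X \<le> 1 + n * (2 + 2 * n)"
  unfolding T_num_edges_def using loop_time_le[of X "\<lambda>_. T_nbrs X" "1 + 2 * n" n] T_nbrs_le[of X n]
  by simp

text \<open>Positivity of \<open>d\<close> allows lower powers of \<open>d\<close> to be absorbed
  into higher ones.\<close>

locale bounded_degree_bigraph =
  fixes G :: "'v bigraph" and d :: nat
  assumes wf: "wf_bigraph G"
    and deg_le: "\<And>v. v \<in> verts G \<Longrightarrow> deg G v (verts G) \<le> d"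
    and d_pos: "1 \<le> d"
begin

lemma finite_verts: "finite (verts G)"
  using wf by (auto simp: wf_bigraph_def verts_def)

lemma adj_verts: "adj G v w \<Longrightarrow> v \<in> verts G \<and> w \<in> verts G"
  using wf by (auto simp: wf_bigraph_def verts_def adj_def)

lemma nbrs_subset: "nbrs G v A \<subseteq> nbrs G v (verts G)"
  using adj_verts by (auto simp: nbrs_def)

lemma finite_nbrs: "finite (nbrs G v A)"
  by (rule finite_subset[OF nbrs_subset]) (simp add: nbrs_def finite_verts)

lemma card_nbrs_le: "card (nbrs G v A) \<le> d"
proof -
  have "card (nbrs G v A) \<le> card (nbrs G v (verts G))"
    by (intro card_mono nbrs_subset finite_nbrs)
  also have "\<dots> \<le> d"
  proof (cases "v \<in> verts G")
    case True
    then show ?thesis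
      using deg_le by (simp add: deg_def)
  next
    case False
    then have "nbrs G v (verts G) = {}"
      using adj_verts by (auto simp: nbrs_def)
    then show ?thesis by simp
  qed
  finally show ?thesis .
qed

lemma card_UN_nbrs_le: "finite A \<Longrightarrow> card (\<Union>v\<in>A. nbrs G v B) \<le> card A * d"
  using card_UN_le[of A "\<lambda>v. nbrs G v B"] sum_bounded_above[of A "\<lambda>v. card (nbrs G v B)" d]
    card_nbrs_le by (auto intro: order_trans)

text \<open>\<open>opp\<close> treats every vertex outside \<open>lefts G\<close> as a right vertex,
  and the sides are disjoint, so \<open>opp G v\<close> never contains \<open>v\<close>.\<close>

lemma self_notin_nonnbrs: "v \<notin> nonnbrs G v A"
  using wf by (auto simp: nonnbrs_def opp_def wf_bigraph_def)

lemma T_adj_list_le: "T_adj_list G v \<le> 1 + 2 * d"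
  unfolding T_adj_list_def
  using loop_time_le[OF finite_nbrs, of v "verts G" "\<lambda>_. 1" 1 d] card_nbrs_le[of v "verts G"] by simp

lemma T_adj_lists_le:
  "finite X \<Longrightarrow> card X \<le> n \<Longrightarrow> T_adj_lists G X \<le> 1 + n * (2 + 2 * d)"
  unfolding T_adj_lists_def
  using loop_time_le[of X "T_adj_list G" "1 + 2 * d" n] T_adj_list_le by simp

text \<open>The size of \<open>D\<close> does not enter: a member with a neighbour in
  \<open>X\<close> lies in the neighbourhood of some vertex of \<open>X\<close>, which leaves at
  most \<open>n * d\<close> members to be tested.\<close>

lemma T_excluded_le:
  assumes "finite X" "card X \<le> n" "\<And>v. v \<in> D \<Longrightarrow> t v \<le> c"
  shows "T_excluded G X D t
    \<le> (1 + n * (2 + 2 * d)) + (1 + n * d * (1 + c)) + (1 + n * (2 + 2 * n))"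
proof -
  let ?D = "{v \<in> D. nbrs G v X \<noteq> {}}"
  have sub: "?D \<subseteq> (\<Union>x\<in>X. nbrs G x (verts G))"
    using adj_verts by (auto simp: nbrs_def adj_def)
  have fin: "finite (\<Union>x\<in>X. nbrs G x (verts G))"
    using assms(1) finite_nbrs by auto
  have "card ?D \<le> n * d"
    using card_mono[OF fin sub] card_UN_nbrs_le[OF assms(1)] assms(2)
    by (meson mult_le_mono1 order_trans)
  then have "loop_time ?D t \<le> 1 + n * d * (1 + c)"
    using finite_subset[OF sub fin] assms(3) by (intro loop_time_le) auto
  then show ?thesis
    unfolding T_excluded_def
    using T_adj_lists_le[OF assms(1,2)] T_biplex_le[OF assms(1,2)] by linarith
qed

text \<open>The dominant work at a node with at most \<open>n\<close> vertices in
  \<open>S \<union> C\<close>: up to \<open>n\<close> children, for each of them up to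
  \<open>n * d\<close> excluded vertices, and for each of these a biplex test of order
  \<open>n ^ 2\<close>. The factor 1000 leaves room for all other terms.\<close>

definition node_cost :: "nat \<Rightarrow> nat" where
  "node_cost n = 1000 * n ^ 4 * d"

text \<open>The extra summand \<open>1 + m\<close> stands for the unit costs of processing the list
  of \<open>m\<close> children, so that the induction over the search tree needs no further error
  term.\<close>

lemma node_time_le:
  assumes fin: "finite S" "finite C" and card: "card (S \<union> C) \<le> n" and n: "1 \<le> n" and m: "m \<le> card C"
    and ws: "set ws \<subseteq> C"
  shows "T_leaf (S, C, D) + T_prune G (S, C, D) + T_branch G (S, C, D) ws m + 1 + m \<le> node_cost n"
proof -
  have cS: "card S \<le> n" and cC: "card C \<le> n"
    using card card_mono[of "S \<union> C"] fin by (meson Un_upper1 Un_upper2 finite_UnI order_trans)+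
  have finSC: "finite (S \<union> C)"
    using fin by simp
  have nn: "n \<le> n ^ 2" "n\<^sup>2 \<le> n ^ 3" "n ^ 3 \<le> n ^ 4" "1 \<le> n ^ 2"
    using n by (auto intro: power_increasing self_le_power)
  have nb: "T_nbrs X \<le> 3 * n" if "X \<subseteq> S \<union> C" for X
    using T_nbrs_le[of X n] card_mono[OF finSC that] finite_subset[OF that finSC] card n by linarith
  have bip: "T_biplex X \<le> 5 * n ^ 2" "T_num_edges X \<le> 5 * n ^ 2" if "X \<subseteq> S \<union> C" for X
  proof -
    have "1 + n * (2 + 2 * n) = 1 + 2 * n + 2 * n ^ 2"
      by (simp add: algebra_simps power2_eq_square)
    moreover have "finite X" "card X \<le> n"
      using card_mono[OF finSC that] finite_subset[OF that finSC] card by auto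
    ultimately show "T_biplex X \<le> 5 * n ^ 2" "T_num_edges X \<le> 5 * n ^ 2"
      using T_biplex_le[of X n] T_num_edges_le[of X n] nn by linarith+
  qed
  \<comment> \<open>The inserted vertex may be an excluded one outside \<open>S \<union> C\<close>,
    hence \<open>n + 1\<close> in place of \<open>n\<close>.\<close>
  have bip': "T_biplex (insert v X) \<le> 13 * n ^ 2" if "X \<subseteq> S \<union> C" for v X
  proof -
    have "finite X" "card X \<le> n"
      using card_mono[OF finSC that] finite_subset[OF that finSC] card by auto
    then have "T_biplex (insert v X) \<le> 1 + (n + 1) * (2 + 2 * (n + 1))"
      using T_biplex_le[of "insert v X" "n + 1"] by (simp add: card_insert_if)
    also have "\<dots> = 2 * n ^ 2 + 6 * n + 5"
      by (simp add: algebra_simps power2_eq_square)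
    finally show ?thesis
      using nn by linarith
  qed
  \<comment> \<open>The bound \<open>13 * n ^ 2\<close> covers both tests made on excluded vertices:
    the domination test of the pruning rules and the biplex test when a child is built.\<close>
  have excl: "T_excluded G X D t \<le> 25 * (n ^ 3 * d)"
    if "X \<subseteq> S \<union> C" "\<And>v. v \<in> D \<Longrightarrow> t v \<le> 13 * n ^ 2" for X D t
  proof -
    have "finite X" "card X \<le> n"
      using card_mono[OF finSC that(1)] finite_subset[OF that(1) finSC] card by auto
    then have "T_excluded G X D t
      \<le> (1 + n * (2 + 2 * d)) + (1 + n * d * (1 + 13 * n ^ 2)) + (1 + n * (2 + 2 * n))"
      using that(2) by (intro T_excluded_le)
    also have "\<dots> = 3 + 4 * n + 3 * (n * d) + 13 * (n ^ 3 * d) + 2 * n ^ 2"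
      by (simp add: algebra_simps eval_nat_numeral)
    also have "\<dots> \<le> 25 * (n ^ 3 * d)"
    proof -
      have "n ^ 3 * 1 \<le> n ^ 3 * d" "n * d \<le> n ^ 3 * d"
        using d_pos nn by (intro mult_le_mono; linarith)+
      then show ?thesis using nn n by linarith
    qed
    finally show ?thesis .
  qed
  have leaf: "T_leaf (S, C, D) \<le> 13 * n ^ 2"
    using bip[of "S \<union> C"] loop_time_le[OF finSC, of "\<lambda>_. 1" 1 n] card nn by (simp add: T_leaf_def)
  have scan: "loop_time X (\<lambda>_. T_nbrs (S \<union> C)) \<le> 5 * n ^ 2" if "X \<subseteq> S \<union> C" for X
  proof -
    have "finite X" "card X \<le> n"
      using card_mono[OF finSC that(1)] finite_subset[OF that(1) finSC] card by auto
    then have "loop_time X (\<lambda>_. T_nbrs (S \<union> C)) \<le> 1 + n * (1 + 3 * n)"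
      using nb[of "S \<union> C"] by (intro loop_time_le) auto
    also have "\<dots> = 1 + n + 3 * n ^ 2"
      by (simp add: algebra_simps power2_eq_square)
    finally show ?thesis using nn by linarith
  qed
  have nd: "n ^ 2 \<le> n ^ 3 * d" "n ^ 3 * d \<le> n ^ 4 * d" "n ^ 4 \<le> n ^ 4 * d"
    using mult_le_mono[OF nn(2) d_pos] nn(3) d_pos by auto
  have "T_excluded G (S \<union> C) D (\<lambda>_. T_nbrs (S \<union> C) + loop_time (S \<union> C) (\<lambda>_. T_nbrs (S \<union> C)))
    \<le> 25 * (n ^ 3 * d)"
    using nb[of "S \<union> C"] scan[of "S \<union> C"] nn by (intro excl) auto
  moreover have "S \<subseteq> S \<union> C" "S \<union> C \<subseteq> S \<union> C"
    by auto
  ultimately have "T_prune G (S, C, D) \<le> 15 * n ^ 2 + 25 * (n ^ 3 * d)"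
    using bip(1)[of S] scan[of S] bip(2)[of "S \<union> C"]
    unfolding T_prune_def prod.case by linarith
  then have prune: "T_prune G (S, C, D) \<le> 40 * (n ^ 4 * d)"
    using nd by linarith
  have child: "T_child G (S, C, D) ws j \<le> 44 * (n ^ 3 * d)" for j
  proof -
    let ?S = "S \<union> set (take j ws)"
    have sub: "?S \<subseteq> S \<union> C"
      using ws set_take_subset[of j ws] by blast
    have "loop_time (C - set (take (Suc j) ws)) (\<lambda>v. T_biplex (insert v ?S)) \<le> 1 + n * (1 + 13 * n ^ 2)"
      using fin cC bip'[OF sub] card_Diff_subset_Int[of C]
      by (intro loop_time_le) (auto intro: order_trans[OF card_mono, of C])
    also have "\<dots> = 1 + n + 13 * n ^ 3"
      by (simp add: algebra_simps eval_nat_numeral)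
    finally have "loop_time (C - set (take (Suc j) ws)) (\<lambda>v. T_biplex (insert v ?S)) \<le> 15 * n ^ 3"
      using nn n by linarith
    moreover have "loop_time (S \<union> C) (\<lambda>_. 1) \<le> 1 + 2 * n"
      using loop_time_le[OF finSC, of "\<lambda>_. 1" 1 n] card by simp
    moreover have "T_excluded G ?S (insert (ws ! j) D) (\<lambda>v. T_biplex (insert v ?S)) \<le> 25 * (n ^ 3 * d)"
      by (intro excl sub bip')
    moreover have "n ^ 3 \<le> n ^ 3 * d"
      using d_pos by auto
    ultimately show ?thesis
      unfolding T_child_def prod.case Let_def using nn n by linarith
  qed
  have "loop_time {..<m} (T_child G (S, C, D) ws) \<le> 1 + n * (1 + 44 * (n ^ 3 * d))"
    using child m cC by (intro loop_time_le) auto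
  also have "\<dots> = 1 + n + 44 * (n ^ 4 * d)"
    by (simp add: algebra_simps eval_nat_numeral)
  finally have "loop_time {..<m} (T_child G (S, C, D) ws) \<le> 1 + n + 44 * (n ^ 4 * d)" .
  moreover have "loop_time C (\<lambda>_. 1) \<le> 1 + 2 * n"
    using loop_time_le[OF fin(2), of "\<lambda>_. 1" 1 n] cC by simp
  moreover have "T_nbrs S \<le> 3 * n" "T_nbrs C \<le> 3 * n" "loop_time (S \<union> C) (\<lambda>_. T_nbrs (S \<union> C)) \<le> 5 * n ^ 2"
    using nb scan by auto
  ultimately have "T_branch G (S, C, D) ws m \<le> 5 * n ^ 2 + 9 * n + 2 + 44 * (n ^ 4 * d)"
    unfolding T_branch_def prod.case by linarith
  then show ?thesis
    unfolding node_cost_def using leaf prune nn nd m cC n by linarith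
qed

end

section \<open>Running time of FastBB\<close>

text \<open>The invariant of the recursion. The filter on the candidates in \<open>child\<close>
  restores it at every child, and it bounds by \<open>k\<close> the non-neighbours in
  \<open>S\<close> of a pivot taken from \<open>C\<close>.\<close>

definition admissible :: "'v bigraph \<Rightarrow> nat \<Rightarrow> 'v branch \<Rightarrow> bool" where
  "admissible G k = (\<lambda>(S, C, D). finite S \<and> finite C \<and> (\<forall>v\<in>C. biplex G k (insert v S)))"

definition cands :: "'v branch \<Rightarrow> 'v set" where
  "cands = (\<lambda>(S, C, D). C)"

text \<open>This set never grows along the recursion, so one size bound \<open>n\<close> serves the
  whole search tree.\<close>

definition scope :: "'v branch \<Rightarrow> 'v set" where
  "scope = (\<lambda>(S, C, D). S \<union> C)"

lemma is_pivot_in_pivots: "is_pivot G k S C v \<Longrightarrow> v \<in> pivots G k S C"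
  by (auto simp: is_pivot_def Let_def split: if_splits)

lemma branch_order_set:
  assumes "branch_order G S C v ws" "v \<in> S \<union> C"
  shows "distinct ws \<and> set ws = C"
proof -
  have "nonnbrs G v C \<subseteq> C"
    by (auto simp: nonnbrs_def)
  then show ?thesis
    using assms by (auto simp: branch_order_def split: if_splits)
qed

text \<open>Child \<open>j\<close> (counted from 0) moves \<open>j\<close> candidates into
  \<open>S\<close> and excludes one more, so it loses at least \<open>j + 1\<close> of them; this
  decrease drives both the time bound and termination.\<close>

lemma child_admissible:
  assumes "admissible G k (S, C, D)" "distinct ws" "set ws = C" "j < card C"
  shows "admissible G k (child G k (S, C, D) ws j)"
    and "scope (child G k (S, C, D) ws j) \<subseteq> S \<union> C"
    and "card (cands (child G k (S, C, D) ws j)) + Suc j \<le> card C"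
proof -
  have sub: "set (take i ws) \<subseteq> C" for i
    using assms(3) set_take_subset by metis
  have fin: "finite S" "finite C"
    using assms(1) by (auto simp: admissible_def)
  show "admissible G k (child G k (S, C, D) ws j)"
    using fin by (auto simp: admissible_def child_def Let_def)
  show "scope (child G k (S, C, D) ws j) \<subseteq> S \<union> C"
    using sub by (auto simp: scope_def child_def Let_def)
  have "length ws = card C"
    using assms(2,3) distinct_card by fastforce
  then have "card (set (take (Suc j) ws)) = Suc j"
    using assms(2,4) by (subst distinct_card) auto
  moreover have "card (cands (child G k (S, C, D) ws j)) \<le> card (C - set (take (Suc j) ws))"
    using fin by (intro card_mono) (auto simp: cands_def child_def Let_def)
  moreover have "card (set (take (Suc j) ws)) \<le> card C"
    using sub fin by (intro card_mono)
  ultimately show "card (cands (child G k (S, C, D) ws j)) + Suc j \<le> card C"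
    using sub[of "Suc j"] by (simp add: card_Diff_subset)
qed

text \<open>The leftover summand \<open>2 ^ (n - m)\<close> is at least 1; in the tree recursion it
  pays for the node itself.\<close>

lemma sum_power_two_descending:
  "m \<le> n \<Longrightarrow> (\<Sum>j<m. 2 ^ (n - Suc j)) + 2 ^ (n - m) = (2 :: nat) ^ n"
proof (induction m)
  case (Suc m)
  then have "n - m = Suc (n - Suc m)"
    by simp
  then have "(2 :: nat) ^ (n - m) = 2 ^ (n - Suc m) + 2 ^ (n - Suc m)"
    by simp
  then show ?case
    using Suc by simp
qed simp

section \<open>Exponential bound on the search tree\<close>

context bounded_degree_bigraph
begin

text \<open>The pivot has more than \<open>k\<close> non-neighbours in \<open>S \<union> C\<close>
  but at most \<open>k\<close> in \<open>S\<close>, so \<open>C\<close> contains at least a + 1 of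
  them, where a = \<open>k - nondeg G v S\<close>. A pivot in \<open>C\<close> is itself one more
  element of \<open>C\<close>, not being its own non-neighbour. Hence all children correspond to
  actual positions of the candidate list.\<close>

lemma num_children_le:
  assumes adm: "admissible G k (S, C, D)" and S: "biplex G k S" and v: "v \<in> pivots G k S C"
  shows "num_children G k S v \<le> card C"
proof -
  have fin: "finite S" "finite C"
    using adm by (auto simp: admissible_def)
  have vSC: "v \<in> S \<union> C" and big: "k < nondeg G v (S \<union> C)"
    using v by (auto simp: pivots_def)
  have "nondeg G v S \<le> k"
  proof (cases "v \<in> S")
    case True
    then show ?thesis using S by (simp add: biplex_def)
  next
    case False
    then have "nondeg G v (insert v S) \<le> k"
      using adm vSC by (auto simp: admissible_def biplex_def)
    then show ?thesis
      using nondeg_mono[OF _ subset_insertI[of S v], of G v] fin by simp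
  qed
  then have C: "k - nondeg G v S + 1 \<le> nondeg G v C"
    using big nondeg_Un_le[of G v S C] by linarith
  show ?thesis
  proof (cases "v \<in> S")
    case True
    then show ?thesis
      using C nondeg_le_card[OF fin(2), of G v] by (simp add: num_children_def Let_def)
  next
    case False
    then have "v \<in> C"
      using vSC by simp
    then have "nonnbrs G v C \<subset> C"
      using self_notin_nonnbrs[of v C] by (auto simp: nonnbrs_def)
    then have "nondeg G v C < card C"
      unfolding nondeg_def using fin by (intro psubset_card_mono)
    then show ?thesis
      using C False by (simp add: num_children_def Let_def)
  qed
qed

text \<open>Rule induction with potential \<open>node_cost n * 2 ^ card (cands b)\<close>. The
  children have at most |C| - 1, ..., |C| - m candidates, so their potentials leave at least one
  \<open>node_cost n\<close> of the parent's potential for the work at the node. Pruning is only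
  used as early stopping.\<close>

lemma
  shows fastbb_time_le: "fastbb G k B b H H' t \<Longrightarrow> admissible G k b \<Longrightarrow> card (scope b) \<le> n \<Longrightarrow> 1 \<le> n \<Longrightarrow>
          t \<le> node_cost n * 2 ^ card (cands b)"
    and fastbb_list_time_le: "fastbb_list G k B bs H H' t \<Longrightarrow>
          (\<And>b. b \<in> set bs \<Longrightarrow> admissible G k b \<and> card (scope b) \<le> n) \<Longrightarrow> 1 \<le> n \<Longrightarrow>
          t \<le> 1 + (\<Sum>b\<leftarrow>bs. 1 + node_cost n * 2 ^ card (cands b))"
proof (induction rule: fastbb_fastbb_list.inducts)
  case (terminate S C H' H D)
  \<comment> \<open>A node without recursion is covered by the node estimate with
    \<open>m = 0\<close> and the empty list.\<close>
  then have "T_leaf (S, C, D) \<le> node_cost n"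
    using node_time_le[of S C n 0 "[]" D] by (auto simp: admissible_def scope_def)
  then show ?case
    by (rule order_trans) simp
next
  case (prune S C D H)
  then have "T_leaf (S, C, D) + T_prune G (S, C, D) \<le> node_cost n"
    using node_time_le[of S C n 0 "[]" D] by (auto simp: admissible_def scope_def)
  then show ?case
    by (rule order_trans) simp
next
  case (branch S C D H v ws m H' t)
  let ?K = "node_cost n"
  let ?b = "child G k (S, C, D) ws"
  have piv: "v \<in> pivots G k S C"
    using branch is_pivot_in_pivots by metis
  then have ws: "distinct ws" "set ws = C"
    using branch_order_set[OF branch(4)] by (auto simp: pivots_def)
  \<comment> \<open>Otherwise the first pruning rule would have applied.\<close>
  have "biplex G k S"
    using branch(2) by (auto simp: pruned_def)
  then have m: "m \<le> card C"
    using num_children_le[OF branch(8) _ piv] branch(5) by simp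
  have fin: "finite S" "finite C" and scope: "card (S \<union> C) \<le> n"
    using branch by (auto simp: admissible_def scope_def)
  have sub: "card (scope (?b j)) \<le> n" if "j < m" for j
    using card_mono[OF _ child_admissible(2)[OF branch(8) ws, of j]] fin scope that m by simp
  have "t \<le> 1 + (\<Sum>b\<leftarrow>map ?b [0..<m]. 1 + ?K * 2 ^ card (cands b))"
  proof (rule branch.IH)
    show "admissible G k b \<and> card (scope b) \<le> n" if "b \<in> set (map ?b [0..<m])" for b
    proof -
      obtain j where "j < m" "b = ?b j"
        using \<open>b \<in> _\<close> by auto
      then show ?thesis
        using child_admissible(1)[OF branch(8) ws, of j] sub[of j] m by simp
    qed
  qed (fact branch(10))
  also have "\<dots> = 1 + (\<Sum>j<m. 1 + ?K * 2 ^ card (cands (?b j)))"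
    by (simp add: comp_def interv_sum_list_conv_sum_set_nat atLeast0LessThan)
  also have "\<dots> \<le> 1 + (\<Sum>j<m. 1 + ?K * 2 ^ (card C - Suc j))"
  proof (intro add_left_mono sum_mono mult_left_mono power_increasing)
    show "card (cands (?b j)) \<le> card C - Suc j" if "j \<in> {..<m}" for j
      using child_admissible(3)[OF branch(8) ws, of j] that m by simp
  qed simp_all
  also have "\<dots> = 1 + m + ?K * (\<Sum>j<m. 2 ^ (card C - Suc j))"
    by (simp only: sum.distrib sum_distrib_left) simp
  finally have t: "t \<le> 1 + m + ?K * (\<Sum>j<m. 2 ^ (card C - Suc j))" .
  have "T_leaf (S, C, D) + T_prune G (S, C, D) + T_branch G (S, C, D) ws m + t
    \<le> ?K + ?K * (\<Sum>j<m. 2 ^ (card C - Suc j))"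
    using t node_time_le[OF fin scope branch(10) m, of ws D] ws by simp
  also have "\<dots> \<le> ?K * 2 ^ (card C - m) + ?K * (\<Sum>j<m. 2 ^ (card C - Suc j))"
    by simp
  also have "\<dots> = ?K * 2 ^ card C"
    by (simp only: distrib_left[symmetric] add.commute sum_power_two_descending[OF m, symmetric])
  finally show ?case
    by (simp add: cands_def)
next
  case (empty H)
  then show ?case by simp
next
  case (step b H H1 t1 bs H2 t2)
  then have "t1 \<le> node_cost n * 2 ^ card (cands b)"
    by auto
  moreover have "t2 \<le> 1 + (\<Sum>b\<leftarrow>bs. 1 + node_cost n * 2 ^ card (cands b))"
    using step by auto
  ultimately show ?case by simp
qed

section \<open>Existence of executions of FastBB\<close>

lemma is_pivot_exists:
  assumes "finite S" "finite C" "\<not> biplex G k (S \<union> C)"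
  shows "\<exists>v. is_pivot G k S C v"
proof -
  define P where "P = (if pivots G k S C \<inter> S \<noteq> {} then pivots G k S C \<inter> S else pivots G k S C)"
  have "pivots G k S C \<noteq> {}"
    using assms(3) by (auto simp: pivots_def biplex_def not_le)
  then have P: "P \<noteq> {}"
    by (auto simp: P_def)
  have "finite (pivots G k S C)"
    using assms by (auto simp: pivots_def)
  then have "finite P"
    by (auto simp: P_def)
  then have "Max ((\<lambda>u. nondeg G u (S \<union> C)) ` P) \<in> (\<lambda>u. nondeg G u (S \<union> C)) ` P"
    using P by (intro Max_in) auto
  then obtain v where v: "v \<in> P" "nondeg G v (S \<union> C) = Max ((\<lambda>u. nondeg G u (S \<union> C)) ` P)"
    by auto
  then have "\<forall>u\<in>P. nondeg G u (S \<union> C) \<le> nondeg G v (S \<union> C)"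
    using \<open>finite P\<close> by simp
  then show ?thesis
    unfolding is_pivot_def Let_def P_def[symmetric] using v(1) by blast
qed

lemma branch_order_exists:
  assumes "finite C"
  shows "\<exists>ws. branch_order G S C v ws"
proof -
  have "finite (nonnbrs G v C)"
    using assms by (auto simp: nonnbrs_def)
  then obtain us where us: "set us = nonnbrs G v C" "distinct us"
    using finite_distinct_list by blast
  show ?thesis
  proof (cases "v \<in> S")
    case True
    obtain zs where zs: "set zs = C - nonnbrs G v C" "distinct zs"
      using finite_distinct_list assms by (metis finite_Diff)
    then have "distinct (us @ zs)"
      using us by auto
    then have "branch_order G S C v (us @ zs)"
      unfolding branch_order_def if_P[OF True] using us(1) zs(1) by blast
    then show ?thesis by blast
  next
    case False
    obtain zs where zs: "set zs = C - nonnbrs G v C - {v}" "distinct zs"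
      using finite_distinct_list assms by (metis finite_Diff)
    then have "distinct (v # us @ zs)"
      using us self_notin_nonnbrs[of v C] by auto
    then have "branch_order G S C v (v # us @ zs)"
      unfolding branch_order_def if_not_P[OF False] using us(1) zs(1) by blast
    then show ?thesis by blast
  qed
qed

text \<open>Ensures that the bound on all running times is not vacuous. The number of candidates
  strictly decreases at every child, and pivot and order can always be chosen.\<close>

lemma fastbb_exists: "admissible G k b \<Longrightarrow> \<exists>H' t. fastbb G k B b H H' t"
proof (induction "card (cands b)" arbitrary: b H rule: less_induct)
  case less
  obtain S C D where b: "b = (S, C, D)"
    by (cases b) auto
  have fin: "finite S" "finite C"
    using less.prems by (auto simp: b admissible_def)
  consider "biplex G k (S \<union> C)" | "\<not> biplex G k (S \<union> C)" "pruned G k B (S, C, D) H"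
    | "\<not> biplex G k (S \<union> C)" "\<not> pruned G k B (S, C, D) H"
    by blast
  then show ?case
  proof cases
    case 1
    then show ?thesis
      unfolding b by (blast intro: fastbb_fastbb_list.terminate)
  next
    case 2
    then show ?thesis
      unfolding b by (blast intro: fastbb_fastbb_list.prune)
  next
    case 3
    obtain v ws where v: "is_pivot G k S C v" and ord: "branch_order G S C v ws"
      using is_pivot_exists[OF fin 3(1)] branch_order_exists[OF fin(2)] by blast
    then have ws: "distinct ws" "set ws = C"
      using branch_order_set[OF ord] is_pivot_in_pivots[OF v] by (auto simp: pivots_def)
    have "biplex G k S"
      using 3 by (auto simp: pruned_def)
    then have m: "num_children G k S v \<le> card C"
      using num_children_le less.prems is_pivot_in_pivots[OF v] by (simp add: b)
    let ?bs = "map (child G k (S, C, D) ws) [0..<num_children G k S v]"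
    have ex: "\<exists>H' t. fastbb G k B c H H' t" if c: "c \<in> set ?bs" for c H
    proof -
      obtain j where j: "j < num_children G k S v" "c = child G k (S, C, D) ws j"
        using c by auto
      then have "j < card C"
        using m by simp
      show ?thesis
        using child_admissible[OF less.prems[unfolded b] ws \<open>j < card C\<close>] j(2)
        by (intro less.hyps) (auto simp: b cands_def)
    qed
    \<comment> \<open>The best solution is handed from each child to the next, so the induction over
      the list must leave \<open>H\<close> arbitrary.\<close>
    have "\<exists>H' t. fastbb_list G k B bs H H' t" if "set bs \<subseteq> set ?bs" for bs H
      using that
    proof (induction bs arbitrary: H)
      case Nil
      show ?case by (blast intro: fastbb_fastbb_list.empty)
    next
      case (Cons c bs)
      then have "c \<in> set ?bs" "set bs \<subseteq> set ?bs"
        unfolding list.set by blast+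
      then obtain H1 t1 H2 t2 where "fastbb G k B c H H1 t1" "fastbb_list G k B bs H1 H2 t2"
        using ex Cons.IH by meson
      then show ?case
        by (blast intro: fastbb_fastbb_list.step)
    qed
    from this[OF order_refl] obtain H' t where "fastbb_list G k B ?bs H H' t"
      by blast
    then show ?thesis
      unfolding b using fastbb_fastbb_list.branch[OF 3 v ord refl] by blast
  qed
qed

end

section \<open>Running time of PBIE\<close>

context bounded_degree_bigraph
begin

text \<open>Double counting of the adjacent pairs between the two sets.\<close>

lemma sum_deg_swap:
  assumes "finite A" "finite A'"
  shows "(\<Sum>v\<in>A. deg G v A') = (\<Sum>w\<in>A'. deg G w A)"
proof -
  have deg_sum: "deg G v B = (\<Sum>w\<in>B. if adj G v w then 1 else 0)" if "finite B" for v B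
    using that by (simp add: deg_def nbrs_def sum.If_cases Int_def)
  have "(\<Sum>v\<in>A. deg G v A') = (\<Sum>w\<in>A'. \<Sum>v\<in>A. if adj G v w then 1 else 0)"
    using assms by (simp only: deg_sum) (rule sum.swap)
  also have "\<dots> = (\<Sum>w\<in>A'. deg G w A)"
    using assms by (simp only: deg_sum) (auto simp: adj_def intro!: sum.cong)
  finally show ?thesis .
qed

text \<open>Every 2-hop neighbour is a neighbour of one of at most \<open>d\<close> neighbours of
  \<open>v\<close>. Only \<open>v\<close> itself may fall outside these, when it has no
  neighbour.\<close>

lemma hop_left_bounds:
  shows finite_hop_left: "finite (hop_left G X P v)"
    and card_hop_left_diff_le: "card (hop_left G X P v - {v}) \<le> d ^ 2"
    and card_hop_left_le: "card (hop_left G X P v) \<le> 1 + d ^ 2"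
proof -
  let ?U = "\<Union>u\<in>nbrs G v (verts G). nbrs G u (verts G)"
  have sub: "hop_left G X P v \<subseteq> insert v ?U"
    using adj_verts by (auto simp: hop_left_def nbrs_def adj_def)
  have fin: "finite ?U"
    using finite_nbrs by auto
  show fin': "finite (hop_left G X P v)"
    using sub fin by (rule finite_subset[OF _ finite.insertI])
  have "card (hop_left G X P v - {v}) \<le> card ?U"
    using sub fin by (intro card_mono) auto
  also have "\<dots> \<le> card (nbrs G v (verts G)) * d"
    by (intro card_UN_nbrs_le finite_nbrs)
  also have "\<dots> \<le> d ^ 2"
    using card_nbrs_le[of v "verts G"] by (simp add: power2_eq_square)
  finally show diff: "card (hop_left G X P v - {v}) \<le> d ^ 2" .
  then show "card (hop_left G X P v) \<le> 1 + d ^ 2"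
    using card_Diff_singleton_if[of "hop_left G X P v" v] by (auto split: if_splits)
qed

lemma finite_hop_right: "finite (hop_right G X P v)"
  using finite_hop_left finite_nbrs by (auto simp: hop_right_def)

lemma card_hop_right_le: "card (hop_right G X P v) \<le> (1 + d ^ 2) * d"
  unfolding hop_right_def
  using card_UN_nbrs_le[OF finite_hop_left] card_hop_left_le by (meson mult_le_mono1 order_trans)

text \<open>A right vertex that survives pruning has at least \<open>\<theta>\<^sub>L - k\<close>
  \<ge> 2 neighbours in \<open>A\<close>, while \<open>A\<close> sends out at most (1 + d^2) * d
  edges; so only half of the trivial number of right vertices remains. This halving of the leading
  term d^3 is what brings the base of the exponential from 2 down to the square root of 2.\<close>

lemma card_start_candidates_le:
  assumes k: "1 \<le> k" and \<theta>: "2 * k + 1 \<le> \<theta>\<^sub>L"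
  shows "2 * card (local_verts G k \<theta>\<^sub>L \<theta>\<^sub>R X P v - P - {v}) \<le> d ^ 3 + 3 * d ^ 2"
proof -
  define A where "A = hop_left G X P v"
  define Z where "Z = {u \<in> hop_right G X P v. int (deg G u A) \<ge> int \<theta>\<^sub>L - int k}"
  have fin: "finite A" "finite Z"
    using finite_hop_left finite_hop_right by (auto simp: A_def Z_def)
  have "2 \<le> deg G u A" if "u \<in> Z" for u
    using that k \<theta> by (auto simp: Z_def)
  then have "card Z * 2 \<le> (\<Sum>u\<in>Z. deg G u A)"
    using sum_bounded_below[of Z 2 "\<lambda>u. deg G u A"] by auto
  also have "\<dots> = (\<Sum>w\<in>A. deg G w Z)"
    using fin by (intro sum_deg_swap)
  also have "\<dots> \<le> card A * d"
    using sum_bounded_above[of A "\<lambda>w. deg G w Z" d] card_nbrs_le by (auto simp: deg_def)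
  also have "\<dots> \<le> (1 + d ^ 2) * d"
    unfolding A_def by (intro mult_le_mono1 card_hop_left_le)
  also have "\<dots> = d + d ^ 3"
    by (simp add: algebra_simps eval_nat_numeral)
  finally have Z: "card Z * 2 \<le> d + d ^ 3" .
  have "local_verts G k \<theta>\<^sub>L \<theta>\<^sub>R X P v - P - {v} \<subseteq> (A - {v}) \<union> Z"
    by (auto simp: local_verts_def Let_def A_def Z_def)
  then have "card (local_verts G k \<theta>\<^sub>L \<theta>\<^sub>R X P v - P - {v}) \<le> card ((A - {v}) \<union> Z)"
    using fin by (intro card_mono) auto
  also have "\<dots> \<le> d ^ 2 + card Z"
    using card_Un_le[of "A - {v}" Z] card_hop_left_diff_le[of X P v] by (simp add: A_def)
  finally show ?thesis
    \<comment> \<open>The left side contributes 2 * d^2, and the remaining \<open>d\<close> is at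
      most d^2.\<close>
    using Z d_pos self_le_power[of d 2] by linarith
qed

section \<open>Cost of one start branch\<close>

lemma finite_local_verts: "finite (local_verts G k \<theta>\<^sub>L \<theta>\<^sub>R X P v)"
  using finite_hop_left finite_hop_right by (simp add: local_verts_def Let_def)

text \<open>In a set of two vertices each has at most one non-neighbour, and
  \<open>k \<ge> 1\<close>.\<close>

lemma start_branch_admissible:
  assumes "1 \<le> k"
  shows "admissible G k (start_branch G k \<theta>\<^sub>L \<theta>\<^sub>R X P v)"
proof -
  have "nondeg G x {w, v} \<le> k" if "x \<in> {w, v}" for x w
  proof -
    have "nonnbrs G x {w, v} \<subseteq> {w, v} - {x}"
      using self_notin_nonnbrs[of x "{w, v}"] by (auto simp: nonnbrs_def)
    then have "nondeg G x {w, v} \<le> card ({w, v} - {x})"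
      unfolding nondeg_def by (intro card_mono) auto
    also have "\<dots> \<le> 1"
      using that by (auto simp: card_insert_if card_Diff_singleton_if)
    finally show ?thesis using assms by simp
  qed
  then show ?thesis
    using finite_local_verts by (auto simp: admissible_def start_branch_def biplex_def)
qed

lemma fastbb_start_time_le:
  assumes k: "1 \<le> k" and \<theta>: "2 * k + 1 \<le> \<theta>\<^sub>L"
    and run: "fastbb G k B (start_branch G k \<theta>\<^sub>L \<theta>\<^sub>R X P v) H H' t"
  shows "t \<le> 81000 * d ^ 13 * 2 ^ ((d ^ 3 + 3 * d ^ 2) div 2)"
proof -
  let ?b = "start_branch G k \<theta>\<^sub>L \<theta>\<^sub>R X P v"
  let ?C = "local_verts G k \<theta>\<^sub>L \<theta>\<^sub>R X P v - P - {v}"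
  have C: "2 * card ?C \<le> d ^ 3 + 3 * d ^ 2"
    using k \<theta> by (rule card_start_candidates_le)
  have d: "d ^ 2 \<le> d ^ 3" "1 \<le> d ^ 3"
    using d_pos by (auto intro: power_increasing)
  have "card (scope ?b) \<le> card {v} + card ?C"
    using card_Un_le[of "{v}" ?C] by (simp add: scope_def start_branch_def)
  \<comment> \<open>Half of d^3 + 3 * d^2 is at most 2 * d^3, and the start vertex adds 1.\<close>
  also have "\<dots> \<le> 3 * d ^ 3"
    using C d by simp
  finally have "t \<le> node_cost (3 * d ^ 3) * 2 ^ card (cands ?b)"
    using d by (intro fastbb_time_le[OF run start_branch_admissible[OF k]]) auto
  \<comment> \<open>81000 = 1000 * 3^4, and the power is (d^3)^4 * d from
    \<open>node_cost\<close>.\<close>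
  also have "\<dots> = 81000 * d ^ 13 * 2 ^ card ?C"
  proof -
    have "d ^ 13 = (d ^ 3) ^ 4 * d"
      by (simp flip: power_mult power_Suc2)
    then show ?thesis
      by (simp add: node_cost_def power_mult_distrib cands_def start_branch_def)
  qed
  also have "\<dots> \<le> 81000 * d ^ 13 * 2 ^ ((d ^ 3 + 3 * d ^ 2) div 2)"
    using C by (intro mult_left_mono power_increasing) auto
  finally show ?thesis .
qed

text \<open>The scan of all pairs between O(d^2) left and O(d^3) right vertices costs O(d^5); the
  exponent 13 merely matches the bound on the FastBB run.\<close>

lemma T_start_branch_le: "T_start_branch G X P v \<le> 100 * d ^ 13"
proof -
  let ?A = "hop_left G X P v" and ?Z = "hop_right G X P v"
  have d: "1 \<le> d ^ 2" "d \<le> d ^ 5" "d ^ 2 \<le> d ^ 5" "d ^ 3 \<le> d ^ 5" "d ^ 5 \<le> d ^ 13" "1 \<le> d ^ 5" "d \<le> d ^ 3"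
    using d_pos by (auto intro: power_increasing self_le_power)
  have A: "finite ?A" "card ?A \<le> 2 * d ^ 2"
    using finite_hop_left card_hop_left_le[of X P v] d by (auto intro: order_trans)
  have "(1 + d ^ 2) * d = d + d ^ 3"
    by (simp add: algebra_simps eval_nat_numeral)
  then have Z: "finite ?Z" "card ?Z \<le> 2 * d ^ 3"
    using finite_hop_right card_hop_right_le[of X P v] d by auto
  have "T_adj_lists G (nbrs G v (verts G)) \<le> 1 + 2 * d + 2 * d ^ 2"
    using T_adj_lists_le[OF finite_nbrs card_nbrs_le, of v "verts G"]
    by (simp add: algebra_simps power2_eq_square)
  moreover have "T_adj_lists G ?A \<le> 1 + 4 * d ^ 2 + 4 * d ^ 3"
    using T_adj_lists_le[OF A] by (simp add: algebra_simps eval_nat_numeral)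
  moreover have "loop_time ?A (\<lambda>_. T_nbrs ?Z + T_nbrs ?Z) \<le> 1 + 6 * d ^ 2 + 16 * d ^ 5"
  proof -
    have "loop_time ?A (\<lambda>_. T_nbrs ?Z + T_nbrs ?Z) \<le> 1 + (2 * d ^ 2) * (1 + (2 + 8 * d ^ 3))"
      using T_nbrs_le[OF Z] A by (intro loop_time_le) auto
    then show ?thesis by (simp add: algebra_simps eval_nat_numeral)
  qed
  moreover have "loop_time ?Z (\<lambda>_. T_nbrs ?A) \<le> 1 + 4 * d ^ 3 + 8 * d ^ 5"
  proof -
    have "loop_time ?Z (\<lambda>_. T_nbrs ?A) \<le> 1 + (2 * d ^ 3) * (1 + (1 + 4 * d ^ 2))"
      using T_nbrs_le[OF A] Z by (intro loop_time_le) auto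
    then show ?thesis by (simp add: algebra_simps eval_nat_numeral)
  qed
  moreover have "loop_time (?A \<union> ?Z) (\<lambda>_. 1) \<le> 1 + 4 * d ^ 2 + 4 * d ^ 3"
    using loop_time_le[of "?A \<union> ?Z" "\<lambda>_. 1" 1 "2 * d ^ 2 + 2 * d ^ 3"] A Z card_Un_le[of ?A ?Z]
    by simp
  ultimately have "T_start_branch G X P v \<le> 6 + 4 * d + 16 * d ^ 2 + 12 * d ^ 3 + 24 * d ^ 5"
    unfolding T_start_branch_def Let_def using T_adj_list_le[of v] by linarith
  then show ?thesis
    using d by linarith
qed

text \<open>81000 for the FastBB run, 100 for building the start branch, 1 for the step, rounded
  up.\<close>

definition start_cost :: nat where
  "start_cost = 82000 * d ^ 13 * 2 ^ ((d ^ 3 + 3 * d ^ 2) div 2)"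

lemma pbie_scan_time_le:
  assumes "1 \<le> k" "2 * k + 1 \<le> \<theta>\<^sub>L" "pbie_scan G k \<theta>\<^sub>L \<theta>\<^sub>R B X vs ws H H' t"
  shows "t \<le> 1 + length ws * start_cost"
  using assms(3)
proof induction
  case (scan_step vs v H H1 t1 ws H2 t2)
  let ?e = "(d ^ 3 + 3 * d ^ 2) div 2"
  have "1 * 1 \<le> d ^ 13 * 2 ^ ?e" "d ^ 13 * 1 \<le> d ^ 13 * 2 ^ ?e"
    using d_pos by (intro mult_le_mono; simp)+
  then have "1 + T_start_branch G X (set vs) v + t1 \<le> start_cost"
    using T_start_branch_le[of X "set vs" v] fastbb_start_time_le[OF assms(1,2) scan_step(1)]
    unfolding start_cost_def by linarith
  then show ?case
    using scan_step.IH by simp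
qed simp

lemma pbie_scan_exists:
  assumes "1 \<le> k"
  shows "\<exists>H' t. pbie_scan G k \<theta>\<^sub>L \<theta>\<^sub>R B X vs ws H H' t"
proof (induction ws arbitrary: vs H)
  case Nil
  show ?case by (blast intro: pbie_scan.scan_end)
next
  case (Cons v ws)
  then show ?case
    using fastbb_exists[OF start_branch_admissible[OF assms]] by (meson pbie_scan.scan_step)
qed

section \<open>Cost of a round and number of rounds\<close>

lemma finite_lefts: "finite (lefts G)"
  using wf by (simp add: wf_bigraph_def)

text \<open>Non-isolated right vertices are neighbours of left ones, so there are at most |L| * d of
  them; this keeps the size of the right side out of the bound.\<close>

lemma T_core_le:
  assumes "lefts G \<noteq> {}"
  shows "T_core G \<le> 18 * (card (lefts G) * d ^ 2)"
proof -
  define l where "l = card (lefts G)"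
  define Y where "Y = lefts G \<union> {u \<in> rights G. nbrs G u (lefts G) \<noteq> {}}"
  have sub: "Y \<subseteq> lefts G \<union> (\<Union>v\<in>lefts G. nbrs G v (verts G))"
    by (auto simp: Y_def nbrs_def adj_def verts_def)
  have fin: "finite (lefts G \<union> (\<Union>v\<in>lefts G. nbrs G v (verts G)))"
    using finite_lefts finite_nbrs by auto
  have "card Y \<le> l + l * d"
    using card_mono[OF fin sub] card_Un_le card_UN_nbrs_le[OF finite_lefts]
    unfolding l_def by (meson add_left_mono order_trans)
  then have "T_adj_lists G Y \<le> 1 + (l + l * d) * (2 + 2 * d)"
    using finite_subset[OF sub fin] by (intro T_adj_lists_le)
  also have "\<dots> = 1 + 2 * l + 4 * (l * d) + 2 * (l * d ^ 2)"
    by (simp add: algebra_simps eval_nat_numeral)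
  also have "\<dots> \<le> 9 * (l * d ^ 2)"
  proof -
    have "1 \<le> l" "1 \<le> d ^ 2" "d \<le> d ^ 2"
      using assms finite_lefts d_pos
      by (auto simp: l_def Suc_le_eq card_gt_0_iff intro: self_le_power)
    then have "1 * 1 \<le> l * d ^ 2" "l * 1 \<le> l * d ^ 2" "l * d \<le> l * d ^ 2"
      by (intro mult_le_mono; simp)+
    then show ?thesis by linarith
  qed
  finally show ?thesis
    by (simp add: T_core_def Y_def l_def)
qed

text \<open>The added 2 accounts for the unit costs of a round and of the end of its scan.\<close>

lemma T_core_start_cost_le:
  assumes L: "lefts G \<noteq> {}"
  shows "T_core G + 2 \<le> card (lefts G) * start_cost"
proof -
  let ?e = "(d ^ 3 + 3 * d ^ 2) div 2"
  have d: "d ^ 2 \<le> d ^ 13" "1 \<le> d ^ 2"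
    using d_pos by (auto intro: power_increasing)
  have "20 * (d ^ 2 * 1) \<le> 82000 * (d ^ 13 * 2 ^ ?e)"
    using d by (intro mult_le_mono) auto
  then have "card (lefts G) * (20 * d ^ 2) \<le> card (lefts G) * start_cost"
    by (intro mult_left_mono) (auto simp: start_cost_def)
  then have "20 * (card (lefts G) * d ^ 2) \<le> card (lefts G) * start_cost"
    by (simp only: mult.left_commute)
  moreover have "1 * 1 \<le> card (lefts G) * d ^ 2"
    using L finite_lefts d by (intro mult_le_mono) (auto simp: Suc_le_eq card_gt_0_iff)
  ultimately show ?thesis
    using T_core_le[OF L] by linarith
qed

text \<open>\<open>n\<close> bounds the number of remaining rounds, since the left bound is halved
  until it reaches \<open>\<theta>\<^sub>L\<close>. Each round costs at most twice |L| *
  \<open>start_cost\<close>: once for the scan, once for the core and the unit costs.\<close>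

lemma pbie_loop_time_le:
  assumes k: "1 \<le> k" and \<theta>: "2 * k + 1 \<le> \<theta>\<^sub>L" and L: "lefts G \<noteq> {}"
    and run: "pbie_loop G k \<theta>\<^sub>L \<theta>\<^sub>R UBL H H' t" and n: "UBL \<le> real \<theta>\<^sub>L * 2 ^ n"
  shows "t \<le> 1 + n * (2 * (card (lefts G) * start_cost))"
  using run n
proof (induction arbitrary: n)
  case (loop_end UBL H)
  show ?case by simp
next
  case (loop_step UBL LBL LBR H UBR X vs H1 t1 H2 t2)
  \<comment> \<open>For \<open>n = 0\<close> the loop would already have ended.\<close>
  obtain n' where n: "n = Suc n'"
    using loop_step(1,11) by (cases n) auto
  \<comment> \<open>Needed when the halved bound is cut off at
    \<open>\<theta>\<^sub>L\<close>.\<close>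
  have "real \<theta>\<^sub>L * 1 \<le> real \<theta>\<^sub>L * 2 ^ n'"
    by (intro mult_left_mono) auto
  then have "LBL \<le> real \<theta>\<^sub>L * 2 ^ n'"
    using loop_step(2,11) by (auto simp: n)
  then have t2: "t2 \<le> 1 + n' * (2 * (card (lefts G) * start_cost))"
    by (rule loop_step.IH)
  have "length vs = card (X \<inter> lefts G)"
    using loop_step(6,7) distinct_card by fastforce
  also have "\<dots> \<le> card (lefts G)"
    using finite_lefts by (intro card_mono) auto
  finally have "length vs * start_cost \<le> card (lefts G) * start_cost"
    by (rule mult_le_mono1)
  then have t1: "t1 \<le> 1 + card (lefts G) * start_cost"
    using pbie_scan_time_le[OF k \<theta> loop_step(8)] by linarith
  have "1 + T_core G + 1 \<le> card (lefts G) * start_cost"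
    using T_core_start_cost_le[OF L] by simp
  then show ?case
    using t1 t2 by (simp add: n)
qed

lemma pbie_loop_exists:
  assumes k: "1 \<le> k" and n: "UBL \<le> real \<theta>\<^sub>L * 2 ^ n"
  shows "\<exists>H' t. pbie_loop G k \<theta>\<^sub>L \<theta>\<^sub>R UBL H H' t"
  using n
proof (induction n arbitrary: UBL H)
  case 0
  then show ?case by (auto intro: pbie_loop.loop_end)
next
  case (Suc n)
  show ?case
  proof (cases "UBL \<le> real \<theta>\<^sub>L")
    case True
    then show ?thesis by (blast intro: pbie_loop.loop_end)
  next
    case False
    define LBL where "LBL = max (UBL / 2) (real \<theta>\<^sub>L)"
    define LBR where "LBR = max (real (num_edges G H) / UBL) (real \<theta>\<^sub>R)"
    define X where "X = core G (LBR - real k) (LBL - real k)"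
    have "finite (X \<inter> lefts G)"
      using finite_lefts by simp
    then obtain vs where vs: "distinct vs" "set vs = X \<inter> lefts G"
      using finite_distinct_list by metis
    obtain H1 t1 where scan: "pbie_scan G k \<theta>\<^sub>L \<theta>\<^sub>R
       \<lparr>lb_left = LBL, lb_right = LBR, ub_left = UBL,
        ub_right = real (max_deg G (lefts G) + k)\<rparr> X [] vs H H1 t1"
      using pbie_scan_exists[OF k] by blast
    have "real \<theta>\<^sub>L * 1 \<le> real \<theta>\<^sub>L * 2 ^ n"
      by (intro mult_left_mono) auto
    then have "LBL \<le> real \<theta>\<^sub>L * 2 ^ n"
      using Suc.prems by (auto simp: LBL_def)
    then obtain H2 t2 where "pbie_loop G k \<theta>\<^sub>L \<theta>\<^sub>R LBL H1 H2 t2"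
      using Suc.IH by blast
    then show ?thesis
      using pbie_loop.loop_step[OF _ LBL_def LBR_def refl X_def vs scan] False by fastforce
  qed
qed

end

section \<open>The logarithmic factor and the assembly of the bound\<close>

lemma max_deg_ge:
  assumes "finite A" "v \<in> A"
  shows "deg G v (verts G) \<le> max_deg G A"
  unfolding max_deg_def using assms by (intro Max_ge) auto

text \<open>Rounding up the binary logarithm gives \<open>n\<close>. With \<open>n + 1\<close> \<le>
  log + 2 and log \<ge> 1 the factor is 3, and passing to the natural logarithm costs another
  2.\<close>

lemma two_power_ge_obtain:
  assumes "2 \<le> M"
  obtains n where "real M \<le> 2 ^ n" "real n + 1 \<le> 6 * ln (real M)"
proof -
  define n where "n = nat \<lceil>log 2 (real M)\<rceil>"
  have log1: "1 \<le> log 2 (real M)"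
    using assms by (subst one_le_log_cancel_iff) auto
  have "real M = 2 powr log 2 (real M)"
    using assms by simp
  also have "\<dots> \<le> 2 powr real n"
    unfolding n_def using log1 by (intro powr_mono) linarith+
  finally have "real M \<le> 2 ^ n"
    by (simp add: powr_realpow)
  moreover have "real n + 1 \<le> 3 * log 2 (real M)"
    unfolding n_def using log1 by linarith
  moreover have "log 2 (real M) \<le> 2 * ln (real M)"
  proof -
    \<comment> \<open>From ln x \<le> x - 1 at x = 1/2.\<close>
    have "1 / 2 \<le> ln (2 :: real)"
      using ln_le_minus_one[of "1 / 2 :: real"] by (simp add: ln_div)
    then have "ln (real M) * 1 \<le> ln (real M) * (2 * ln 2)"
      using assms by (intro mult_left_mono) auto
    then show ?thesis
      by (simp add: log_def divide_le_eq)
  qed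
  ultimately show ?thesis
    using that by fastforce
qed

text \<open>The right end of an edge has degree at least 1. Together with \<open>k \<ge> 1\<close>
  this makes the argument of the logarithm at least 2.\<close>

lemma bounded_degree_bigraph_max_deg:
  assumes "wf_bigraph G" "edges G \<noteq> {}"
  shows "bounded_degree_bigraph G (max_deg G (verts G))"
    and "1 \<le> max_deg G (rights G)"
    and "lefts G \<noteq> {}"
proof -
  obtain v u where e: "(v, u) \<in> edges G"
    using assms(2) by auto
  then have uv: "v \<in> lefts G" "u \<in> rights G" and fin: "finite (lefts G)" "finite (rights G)"
    using assms(1) by (auto simp: wf_bigraph_def)
  show "lefts G \<noteq> {}"
    using uv by auto
  have "v \<in> nbrs G u (verts G)" "finite (nbrs G u (verts G))"
    using e uv fin by (auto simp: nbrs_def adj_def verts_def)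
  then have "1 \<le> deg G u (verts G)"
    by (auto simp: deg_def Suc_le_eq card_gt_0_iff)
  moreover have "finite (verts G)" "u \<in> verts G"
    using fin uv by (auto simp: verts_def)
  ultimately show "1 \<le> max_deg G (rights G)" "bounded_degree_bigraph G (max_deg G (verts G))"
    using max_deg_ge[of "rights G" u G] max_deg_ge[of "verts G" _ G] uv fin assms(1)
    by (auto simp: bounded_degree_bigraph_def intro: order_trans)
qed

lemma pbie_time_le:
  fixes G :: "'v bigraph"
  assumes k: "1 \<le> k" and \<theta>: "2 * k + 1 \<le> \<theta>\<^sub>L" and G: "wf_bigraph G" "edges G \<noteq> {}"
    and d: "d = max_deg G (verts G)"
  shows "\<exists>H t. pbie G k \<theta>\<^sub>L \<theta>\<^sub>R H t"
    and "pbie G k \<theta>\<^sub>L \<theta>\<^sub>R H t \<Longrightarrow>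
      real t \<le> 984000 * (ln (real (max_deg G (rights G) + k)) * real (card (lefts G)) *
        (real d ^ 13 * 2 ^ ((d ^ 3 + 3 * d ^ 2) div 2)))"
proof -
  interpret bounded_degree_bigraph G d
    unfolding d using G by (rule bounded_degree_bigraph_max_deg)
  define M where "M = max_deg G (rights G) + k"
  have "2 \<le> M"
    using bounded_degree_bigraph_max_deg(2)[OF G] k by (simp add: M_def)
  then obtain n where n: "real M \<le> 2 ^ n" "real n + 1 \<le> 6 * ln (real M)"
    by (rule two_power_ge_obtain)
  have "1 * 2 ^ n \<le> real \<theta>\<^sub>L * 2 ^ n"
    using \<theta> by (intro mult_right_mono) auto
  then have UBL: "real M \<le> real \<theta>\<^sub>L * 2 ^ n"
    using n by linarith
  show "\<exists>H t. pbie G k \<theta>\<^sub>L \<theta>\<^sub>R H t"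
    using pbie_loop_exists[OF k UBL, of \<theta>\<^sub>R "{}"] by (auto simp: pbie_def M_def)
  have L: "lefts G \<noteq> {}"
    using G by (rule bounded_degree_bigraph_max_deg)
  let ?R = "2 * (card (lefts G) * start_cost)"
  assume "pbie G k \<theta>\<^sub>L \<theta>\<^sub>R H t"
  then obtain t' where t': "pbie_loop G k \<theta>\<^sub>L \<theta>\<^sub>R (real M) {} H t'" "t = T_setup G + t'"
    by (auto simp: pbie_def M_def)
  have "t' \<le> 1 + n * ?R"
    using pbie_loop_time_le[OF k \<theta> L t'(1) UBL] .
  moreover have "T_setup G + 1 \<le> ?R"
    using T_core_start_cost_le[OF L] by (simp add: T_setup_def T_core_def)
  \<comment> \<open>At most \<open>n\<close> rounds, and one further unit \<open>?R\<close> for the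
    setup.\<close>
  ultimately have "t \<le> (n + 1) * ?R"
    using t'(2) by simp
  then have "real t \<le> real ((n + 1) * ?R)"
    by (simp only: of_nat_le_iff)
  also have "\<dots> = (real n + 1) * real ?R"
    by (simp only: of_nat_mult of_nat_add of_nat_1)
  also have "\<dots> \<le> 6 * ln (real M) * real ?R"
    using n(2) by (intro mult_right_mono) auto
  \<comment> \<open>984000 = 6 * 2 * 82000.\<close>
  also have "\<dots> = 984000 * (ln (real M) * real (card (lefts G)) *
      (real d ^ 13 * 2 ^ ((d ^ 3 + 3 * d ^ 2) div 2)))"
    unfolding start_cost_def of_nat_mult of_nat_power of_nat_numeral by (simp only: ac_simps)
  finally show "real t \<le> 984000 * (ln (real (max_deg G (rights G) + k)) * real (card (lefts G)) *
        (real d ^ 13 * 2 ^ ((d ^ 3 + 3 * d ^ 2) div 2)))"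
    by (simp only: M_def)
qed

theorem mainTheorem3:
  shows "\<exists>c::real. c > 0 \<and>
    (\<forall>k \<ge> 1. \<exists>\<gamma>. largest_pos_root k \<gamma> \<and> \<gamma> < 2 \<and>
      (\<forall>\<theta>\<^sub>L \<theta>\<^sub>R (G :: 'v bigraph) d.
         2 * k + 1 \<le> \<theta>\<^sub>L \<longrightarrow> 2 * k + 1 \<le> \<theta>\<^sub>R \<longrightarrow>
         wf_bigraph G \<longrightarrow> edges G \<noteq> {} \<longrightarrow> d = max_deg G (verts G) \<longrightarrow>
         (\<exists>H t. pbie G k \<theta>\<^sub>L \<theta>\<^sub>R H t) \<and>
         (\<forall>H t. pbie G k \<theta>\<^sub>L \<theta>\<^sub>R H t \<longrightarrow>
            real t \<le> c * (ln (real (max_deg G (rights G) + k)) * real (card (lefts G)) *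
                          real d ^ 4 * \<gamma> ^ (d ^ 3)))))"
proof -
  obtain c :: real where c: "1 \<le> c" and bound: "\<And>d e \<gamma>. 2 * e \<le> d ^ 3 + 3 * d ^ 2 \<Longrightarrow> 3 / 2 \<le> \<gamma> \<Longrightarrow>
      real d ^ 9 * 2 ^ e \<le> c * \<gamma> ^ (d ^ 3)"
    using poly_times_two_power_bounded by blast
  show ?thesis
  \<comment> \<open>The constant is fixed before \<open>k\<close>, which is possible because
    \<open>c\<close> serves every \<gamma> \<ge> 3/2.\<close>
  proof (rule exI[of _ "984000 * c"], intro conjI allI impI)
    show "0 < 984000 * c"
      using c by simp
    fix k :: nat
    assume k: "1 \<le> k"
    then obtain \<gamma> where \<gamma>: "largest_pos_root k \<gamma>" "3 / 2 \<le> \<gamma>" "\<gamma> < 2"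
      using largest_pos_root_exists by blast
    have "real t \<le> 984000 * c * (ln (real (max_deg G (rights G) + k)) * real (card (lefts G)) *
        real d ^ 4 * \<gamma> ^ (d ^ 3))"
      if "2 * k + 1 \<le> \<theta>\<^sub>L" "wf_bigraph G" "edges G \<noteq> {}" "d = max_deg G (verts G)"
        "pbie G k \<theta>\<^sub>L \<theta>\<^sub>R H t" for \<theta>\<^sub>L \<theta>\<^sub>R d t :: nat and G :: "'v bigraph" and H
    proof -
      let ?l = "ln (real (max_deg G (rights G) + k)) * real (card (lefts G))"
      have "real t \<le> 984000 * (?l * (real d ^ 13 * 2 ^ ((d ^ 3 + 3 * d ^ 2) div 2)))"
        using that by (intro pbie_time_le(2)[OF k])
      \<comment> \<open>Of the 13 powers of \<open>d\<close>, four are kept for the stated bound and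
        nine are absorbed into the exponential.\<close>
      also have "real d ^ 13 * 2 ^ ((d ^ 3 + 3 * d ^ 2) div 2)
        = real d ^ 4 * (real d ^ 9 * 2 ^ ((d ^ 3 + 3 * d ^ 2) div 2))"
        by (simp flip: power_add mult.assoc)
      also have "984000 * (?l * \<dots>) \<le> 984000 * (?l * (real d ^ 4 * (c * \<gamma> ^ (d ^ 3))))"
        using \<gamma>(2) k by (intro mult_left_mono bound) auto
      finally show ?thesis
        by (simp only: ac_simps)
    qed
    then show "\<exists>\<gamma>. largest_pos_root k \<gamma> \<and> \<gamma> < 2 \<and>
      (\<forall>\<theta>\<^sub>L \<theta>\<^sub>R (G :: 'v bigraph) d.
         2 * k + 1 \<le> \<theta>\<^sub>L \<longrightarrow> 2 * k + 1 \<le> \<theta>\<^sub>R \<longrightarrow>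
         wf_bigraph G \<longrightarrow> edges G \<noteq> {} \<longrightarrow> d = max_deg G (verts G) \<longrightarrow>
         (\<exists>H t. pbie G k \<theta>\<^sub>L \<theta>\<^sub>R H t) \<and>
         (\<forall>H t. pbie G k \<theta>\<^sub>L \<theta>\<^sub>R H t \<longrightarrow>
            real t \<le> 984000 * c * (ln (real (max_deg G (rights G) + k)) * real (card (lefts G)) *
                          real d ^ 4 * \<gamma> ^ (d ^ 3))))"
      using \<gamma> k pbie_time_le(1) by (intro exI[of _ \<gamma>]) blast
  qed
qed

end
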